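(* Let $h>0$ and $k_t>k_\ell>0$ be fixed real numbers, and let $$\alpha=2\,\frac{k_t^2-k_\ell^2}{k_\ell^2+k_t^2}.$$ For $k\in\mathbb{C}$ let $p,q\in\mathbb{C}$ satisfy $p^2=k_\ell^2-k^2$ and $q^2=k_t^2-k^2$. (Symmetric case.) The solutions $k\in\mathbb{C}$ of the symmetric Dirichlet dispersion relation $$k^2\tan(qh)+pq\tan(ph)=0$$ satisfying $\Re(k)\ge 0$ and $\Im(k)\ge 0$ can, up to finitely many of them, be enumerated as a sequence $(k_n)_{n\ge n_0}$ (for some integer $n_0\geq 1$) such that, as $n\to\infty$, $$k_n=\frac{1}{2h}\ln(2\alpha\pi n)-\frac{3}{8hn}+\frac{i}{2h}\left(\pi\left(2n-\frac32\right)-\frac{\ln(2\alpha\pi n)}{2\pi n}-\frac{h^2(k_\ell^2+k_t^2)}{2\pi n}\right)+o\!\left(\frac1n\right).$$ (Antisymmetric case.) The solutions $k\in\mathbb{C}$ of the antisymmetric Dirichlet dispersion relation $$k^2\tan(ph)+pq\tan(qh)=0$$ satisfying $\Re(k)\ge 0$ and $\Im(k)\ge 0$ can, up to finitely many of them, be enumerated as a sequence $(k_n)_{n\ge n_0}$ (for some integer $n_0\geq 1$) such that, as $n\to\infty$, $$k_n=\frac{1}{2h}\ln(2\alpha\pi n)-\frac{1}{8hn}+\frac{i}{2h}\left(\pi\left(2n-\frac12\right)-\frac{\ln(2\alpha\pi n)}{2\pi n}-\frac{h^2(k_\ell^2+k_t^2)}{2\pi n}\right)+o\!\left(\frac1n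\right).$$
   Context: Physical origin: $k_t=\omega\sqrt{\rho/\mu}$ and $k_\ell=\omega\sqrt{\rho/(\lambda+2\mu)}$ are the transverse and longitudinal wavenumbers at frequency $\omega$ of an isotropic elastic plate of height $2h$, density $\rho$ and Lamé parameters $(\lambda,\mu)$ with clamped (Dirichlet) boundaries; only $h>0$ and $k_t>k_\ell>0$ matter here. Convention: the equations are understood in their pole-free form, i.e. $k$ is a solution of the symmetric relation iff $$k^2\sin(qh)\cos(ph)+pq\sin(ph)\cos(qh)=0,$$ and of the antisymmetric relation iff $$k^2\sin(ph)\cos(qh)+pq\sin(qh)\cos(ph)=0.$$ Whether $k$ is a solution does not depend on the choice of the signs of the square roots $p$ and $q$. Concretely one may take $q=ik(1-k_t^2/k^2)^{1/2}$ and $p=ik(1-k_\ell^2/k^2)^{1/2}$ for $k\neq0$ (principal square root), and $q=k_t$, $p=k_\ell$ for $k=0$. *)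

theory Defs
  imports Complex_Main "HOL-Library.Landau_Symbols"
begin

text \<open>
  The dispersion relations are taken in pole-free form, obtained from the tangent form by
  multiplying with \<open>cos (p h) * cos (q h)\<close>.  The wavenumbers
  \<open>p\<close> and \<open>q\<close> are given as functions of \<open>k\<close>; changing the sign of
  \<open>p k\<close> or \<open>q k\<close> changes the left-hand sides by at most a sign.
\<close>

definition sym_dirichlet_solutions ::
  "real \<Rightarrow> (complex \<Rightarrow> complex) \<Rightarrow> (complex \<Rightarrow> complex) \<Rightarrow> complex set" where
  "sym_dirichlet_solutions h p q =
     {k. k\<^sup>2 * sin (q k * of_real h) * cos (p k * of_real h)
         + p k * q k * sin (p k * of_real h) * cos (q k * of_real h) = 0}"

definition antisym_dirichlet_solutions ::
  "real \<Rightarrow> (complex \<Rightarrow> complex) \<Rightarrow> (complex \<Rightarrow> complex) \<Rightarrow> complex set" where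
  "antisym_dirichlet_solutions h p q =
     {k. k\<^sup>2 * sin (p k * of_real h) * cos (q k * of_real h)
         + p k * q k * sin (q k * of_real h) * cos (p k * of_real h) = 0}"

definition closed_first_quadrant :: "complex set" where
  "closed_first_quadrant = {k. Re k \<ge> 0 \<and> Im k \<ge> 0}"

text \<open>
  The terms \<open>k n\<close> with \<open>n \<ge> n0\<close> list, without repetition, all but finitely many elements
  of \<open>S\<close> and nothing else; the values \<open>k n\<close> for \<open>n < n0\<close> are irrelevant.
\<close>

definition enumerates_up_to_finite :: "nat \<Rightarrow> (nat \<Rightarrow> 'a) \<Rightarrow> 'a set \<Rightarrow> bool" where
  "enumerates_up_to_finite n0 k S \<longleftrightarrow>
     inj_on k {n0..} \<and> k ` {n0..} \<subseteq> S \<and> finite (S - k ` {n0..})"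

end

theory Submission
  imports Defs "HOL-Complex_Analysis.Complex_Analysis" "HOL-Real_Asymp.Real_Asymp"
begin

text \<open>
  For \<open>k\<close> large with \<open>Re k \<ge> 0\<close>, product-to-sum formulas and the choice \<open>p, q \<sim> i k\<close> turn the dispersion
  relations, with \<open>z = 2 h k\<close>, into \<open>exp z = \<epsilon> \<alpha> z exp (\<rho> (1/z))\<close>, where \<open>\<epsilon> = 1\<close> in the symmetric and
  \<open>\<epsilon> = -1\<close> in the antisymmetric case, and \<open>\<rho>\<close> is analytic at \<open>0\<close> with \<open>\<rho> 0 = 0\<close> and
  \<open>\<rho>' 0 = h\<^sup>2 (kl\<^sup>2 + kt\<^sup>2)\<close>.  Each branch of the logarithm gives exactly one large solution in the first quadrant,
  by Banach's fixed-point theorem, and inserting the equation into itself twice gives its expansion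
  up to \<open>o(1/n)\<close>.  The solutions of bounded modulus are zeros of a non-constant entire function.
\<close>

section \<open>Perturbations of \<open>exp z = \<alpha> z\<close>\<close>

text \<open>The value of \<open>\<alpha>\<close> is the leading order of the product-to-sum form.
  With \<open>p = i k sl\<close> and \<open>q = i k st\<close> the relations read \<open>(1 - sl st)
  sinh (k h (sl + st)) = \<epsilon> (1 + sl st) sinh (k h (sl - st))\<close>. For large
  \<open>k\<close> one has \<open>1 - sl st ~ (kl^2 + kt^2) / (2 k^2)\<close>,
  \<open>1 + sl st ~ 2\<close> and \<open>sinh (k h (sl - st)) ~ h (kt^2 - kl^2) / (2 k)\<close>, so
  that \<open>sinh (k h (sl + st)) ~ \<epsilon> \<alpha> h k\<close>. This is quadratic in the
  exponential; the half plane \<open>Re k \<ge> 0\<close> leaves only the large root. The sign is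
  carried as a phase, \<open>\<epsilon> = exp (- i b)\<close>, so that one argument serves both
  cases. Only \<open>\<rho>' 0\<close> enters the expansion, and parity in \<open>1/k\<close> makes
  the phase shift its only source. The obstacle on the compact side is that \<open>p\<close> and
  \<open>q\<close> are arbitrary square roots, possibly discontinuous in \<open>k\<close>.\<close>

lemma analytic_imp_lipschitz_near:
  fixes f :: "complex \<Rightarrow> complex"
  assumes "f analytic_on {a}"
  shows "\<exists>\<delta>>0. \<exists>M>0. \<forall>u\<in>cball a \<delta>. \<forall>v\<in>cball a \<delta>. norm (f u - f v) \<le> M * norm (u - v)"
proof -
  obtain e where e: "e > 0" "f holomorphic_on ball a e"
    using assms by (auto simp: analytic_on_def)
  have sub: "cball a (e/2) \<subseteq> ball a e" using e by auto
  have "continuous_on (cball a (e/2)) (deriv f)"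
    using e sub by (meson continuous_on_subset holomorphic_deriv holomorphic_on_imp_continuous_on open_ball)
  then have "bounded (deriv f ` cball a (e/2))"
    by (intro compact_imp_bounded compact_continuous_image) auto
  then obtain M where M: "M > 0" "\<And>z. z \<in> cball a (e/2) \<Longrightarrow> norm (deriv f z) \<le> M"
    by (auto simp: bounded_pos)
  have lip: "norm (f u - f v) \<le> M * norm (u - v)"
    if "u \<in> cball a (e/2)" "v \<in> cball a (e/2)" for u v
  proof (rule field_differentiable_bound[of "cball a (e/2)" f "deriv f"])
    fix z assume "z \<in> cball a (e/2)"
    then show "(f has_field_derivative deriv f z) (at z within cball a (e/2))"
      using e sub by (meson has_field_derivative_at_within holomorphic_derivI open_ball subsetD)
  qed (use M that in auto)
  show ?thesis
    by (rule exI[of _ "e/2"], intro conjI exI[of _ M] ballI lip)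
      (simp_all only: M(1) half_gt_zero_iff e(1))
qed

text \<open>The half plane is convex, avoids the branch cut, and
  \<open>1 / norm z \<le> 1 / Y\<close> bounds the derivative there. Raising \<open>Y\<close> makes
  the logarithm as strong a contraction as desired.\<close>

lemma lipschitz_Ln_upper_half_plane:
  assumes "Y > 0" "Im z \<ge> Y" "Im w \<ge> Y"
  shows "norm (Ln z - Ln w) \<le> (1 / Y) * norm (z - w)"
proof (rule field_differentiable_bound[of "{z. Im z \<ge> Y}" Ln inverse])
  show "convex {z. Im z \<ge> Y}" by (rule convex_halfspace_Im_ge)
next
  fix u assume u: "u \<in> {z. Im z \<ge> Y}"
  have "Im u \<noteq> 0" using u assms by auto
  then have "u \<notin> \<real>\<^sub>\<le>\<^sub>0" by (simp add: complex_nonpos_Reals_iff)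
  then show "(Ln has_field_derivative inverse u) (at u within {z. Im z \<ge> Y})"
    by (rule has_field_derivative_at_within[OF has_field_derivative_Ln])
  have "Y \<le> norm u" using u abs_Im_le_cmod[of u] by simp
  then show "norm (inverse u) \<le> 1 / Y"
    using assms by (simp add: norm_divide inverse_eq_divide frac_le)
qed (use assms in simp_all)

text \<open>
  Taking logarithms, the \<open>n\<close>-th branch of \<open>exp z = \<alpha> z exp (\<rho> (1/z) - i b)\<close> is the fixed-point
  equation \<open>z = T n z\<close>, and \<open>T n\<close> is a contraction of a half plane \<open>Im z \<ge> Y\<close> into itself.
  A solution of large modulus in the first quadrant has \<open>Re z = O(ln |z|)\<close>, so it lies in this half plane.
\<close>

lemma exp_eq_linear_perturbed_fixpoints:
  fixes \<alpha> b B0 :: real and \<rho> :: "complex \<Rightarrow> complex"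
  assumes \<alpha>: "\<alpha> > 0" and \<rho>: "\<rho> analytic_on {0}" "\<rho> 0 = 0"
  defines "T \<equiv> \<lambda>n::nat. \<lambda>z. of_real (ln \<alpha>) + Ln z + \<rho> (1 / z) + \<i> * of_real (2 * pi * n - b)"
  obtains N Z B where "N \<ge> 1" "inj_on Z {N..}"
    "\<And>n. n \<ge> N \<Longrightarrow> Z n = T n (Z n) \<and> Re (Z n) \<ge> 0 \<and> Im (Z n) \<ge> 1 \<and> norm (Z n) \<ge> B0 \<and> norm (\<rho> (1 / Z n)) \<le> 1"
    "\<And>n. n \<ge> N \<Longrightarrow> exp (Z n) = of_real \<alpha> * Z n * exp (\<rho> (1 / Z n) - \<i> * of_real b)"
    "\<And>z. Re z \<ge> 0 \<Longrightarrow> Im z \<ge> 0 \<Longrightarrow> norm z \<ge> B \<Longrightarrow>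
       exp z = of_real \<alpha> * z * exp (\<rho> (1 / z) - \<i> * of_real b) \<Longrightarrow> z \<in> Z ` {N..}"
proof -
  obtain \<delta> where \<delta>: "\<delta> > 0"
    and ex: "\<exists>M>0. \<forall>u\<in>cball 0 \<delta>. \<forall>v\<in>cball 0 \<delta>. norm (\<rho> u - \<rho> v) \<le> M * norm (u - v)"
    using analytic_imp_lipschitz_near[OF \<rho>(1)] by - (erule exE, erule conjE, rule that)
  obtain M where M: "M > 0"
    and ball: "\<forall>u\<in>cball 0 \<delta>. \<forall>v\<in>cball 0 \<delta>. norm (\<rho> u - \<rho> v) \<le> M * norm (u - v)"
    using ex by - (erule exE, erule conjE, rule that)
  have lip: "norm (\<rho> u - \<rho> v) \<le> M * norm (u - v)" if "u \<in> cball 0 \<delta>" "v \<in> cball 0 \<delta>" for u v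
    by (rule ball[rule_format, OF that])
  \<comment> \<open>Here \<open>4\<close> makes \<open>Ln\<close> Lipschitz with constant 1/4,
    \<open>1 / \<delta>\<close> puts \<open>1 / z\<close> into the ball where \<open>\<rho>\<close>
    is Lipschitz, \<open>4 * M\<close> gives both \<open>norm (\<rho> (1 / z)) \<le> 1\<close> and
    another Lipschitz constant 1/4, \<open>exp 1 / \<alpha>\<close> makes
    \<open>ln (\<alpha> * norm z) \<ge> 1\<close> and thus \<open>Re (T n z) \<ge> 0\<close>, and
    \<open>B0\<close> is the modulus asked for.\<close>
  define Y where "Y = Max {4, 1 / \<delta>, 4 * M, exp 1 / \<alpha>, B0}"
  have Y: "Y \<ge> 4" "Y \<ge> 1 / \<delta>" "Y \<ge> 4 * M" "Y \<ge> exp 1 / \<alpha>" "Y \<ge> B0"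
    by (auto simp: Y_def)
  have inv: "1 / z \<in> cball 0 \<delta>" if "norm z \<ge> Y" for z :: complex
  proof -
    have "1 / \<delta> \<le> norm z" using that Y by simp
    moreover have "norm z > 0" using that Y by linarith
    ultimately show ?thesis using \<delta> by (simp add: norm_divide field_simps)
  qed
  have \<rho>1: "norm (\<rho> (1 / z)) \<le> 1" if "norm z \<ge> Y" for z
  proof -
    have "norm (\<rho> (1/z) - \<rho> 0) \<le> M * norm (1/z - 0)"
      using inv[OF that] \<delta> by (intro lip) auto
    also have "\<dots> = M / norm z" by (simp add: norm_divide)
    also have "\<dots> \<le> 1"
    proof -
      have "M \<le> norm z" using that Y M by linarith
      then show ?thesis using M by (simp add: divide_simps)
    qed
    finally show ?thesis using \<rho>(2) by simp
  qed
  have normY: "norm z \<ge> Y" if "Im z \<ge> Y" for z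
    using that abs_Im_le_cmod[of z] by linarith
  have T_lip: "norm (T n z - T n w) \<le> (1/2) * norm (z - w)" if z: "Im z \<ge> Y" and w: "Im w \<ge> Y" for n z w
  proof -
    have nz: "z \<noteq> 0" "w \<noteq> 0" using z w Y by auto
    have "norm (\<rho> (1/z) - \<rho> (1/w)) \<le> M * norm (1/z - 1/w)"
      by (intro lip inv[OF normY] z w)
    also have "norm (1/z - 1/w) = norm (z - w) / (norm z * norm w)"
      using nz by (simp add: divide_simps norm_divide norm_mult norm_minus_commute)
    also have "M * \<dots> \<le> M * (norm (z - w) / (4 * M))"
    proof -
      have "4 * M * 1 \<le> norm z * norm w"
        using normY[OF z] normY[OF w] Y M by (intro mult_mono) linarith+
      then show ?thesis using M by (intro mult_left_mono divide_left_mono) (auto simp: nz)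
    qed
    also have "\<dots> = norm (z - w) / 4" using M by simp
    finally have 1: "norm (\<rho> (1/z) - \<rho> (1/w)) \<le> norm (z - w) / 4" .
    have "norm (Ln z - Ln w) \<le> (1/Y) * norm (z - w)"
      using z w Y by (intro lipschitz_Ln_upper_half_plane) auto
    also have "\<dots> \<le> (1/4) * norm (z - w)"
      using Y by (intro mult_right_mono) (auto simp: divide_simps)
    finally have 2: "norm (Ln z - Ln w) \<le> norm (z - w) / 4" by simp
    have "T n z - T n w = (Ln z - Ln w) + (\<rho> (1/z) - \<rho> (1/w))"
      by (simp add: T_def)
    then have "norm (T n z - T n w) \<le> norm (Ln z - Ln w) + norm (\<rho> (1/z) - \<rho> (1/w))"
      by (simp add: norm_triangle_ineq)
    with 1 2 show ?thesis by simp
  qed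
  \<comment> \<open>In \<open>Im (T n z)\<close> the argument of \<open>z\<close> is positive,
    \<open>\<rho>\<close> costs at most 1 and the phase at most \<open>\<bar>b\<bar>\<close>; the
    rest of \<open>2 * pi * n\<close> has to reach \<open>Y\<close>.\<close>
  define N where "N = nat \<lceil>(Y + 1 + \<bar>b\<bar>) / (2 * pi)\<rceil> + 1"
  have N: "2 * pi * n \<ge> Y + 1 + \<bar>b\<bar>" if "n \<ge> N" for n
  proof -
    have "(Y + 1 + \<bar>b\<bar>) / (2 * pi) \<le> real N" unfolding N_def by linarith
    also have "\<dots> \<le> n" using that by simp
    finally show ?thesis by (simp add: field_simps)
  qed
  have ImT: "Im (T n z) \<ge> Y" if "n \<ge> N" "Im z \<ge> Y" for n z
  proof -
    have "Im (Ln z) > 0" using that Y by (intro conjunct1[OF Im_Ln_pos_lt_imp]) auto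
    moreover have "\<bar>Im (\<rho> (1 / z))\<bar> \<le> 1"
      using \<rho>1[OF normY[OF that(2)]] abs_Im_le_cmod[of "\<rho> (1/z)"] by linarith
    ultimately show ?thesis using N[OF that(1)] by (simp add: T_def)
  qed
  have fix1: "\<exists>!z. z \<in> {z. Im z \<ge> Y} \<and> T n z = z" if "n \<ge> N" for n
  proof (rule Banach_fix)
    show "complete {z. Im z \<ge> Y}"
      by (simp add: complete_eq_closed closed_halfspace_Im_ge)
    have "Complex 0 Y \<in> {z. Im z \<ge> Y}" by simp
    then show "{z. Im z \<ge> Y} \<noteq> {}" by blast
    show "T n ` {z. Im z \<ge> Y} \<subseteq> {z. Im z \<ge> Y}"
      using ImT[OF that] by auto
    show "dist (T n z) (T n w) \<le> 1/2 * dist z w" if "z \<in> {z. Y \<le> Im z}" "w \<in> {z. Y \<le> Im z}" for z w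
      using T_lip that by (simp add: dist_norm)
  qed auto
  define Z where "Z n = (THE z. z \<in> {z. Im z \<ge> Y} \<and> T n z = z)" for n
  have Z: "Im (Z n) \<ge> Y" "T n (Z n) = Z n" if "n \<ge> N" for n
    using theI'[OF fix1[OF that]] by (auto simp: Z_def)
  have Z_unique: "z = Z n" if "n \<ge> N" "Im z \<ge> Y" "T n z = z" for n z
    using fix1[OF that(1)] Z[OF that(1)] that by blast
  have Re_ln: "ln \<alpha> + ln (norm z) + Re (\<rho> (1/z)) \<ge> 0" if "norm z \<ge> Y" for z
  proof -
    have "exp 1 / \<alpha> \<le> norm z" using that Y by linarith
    then have "exp 1 \<le> \<alpha> * norm z" using \<alpha> by (simp add: field_simps)
    moreover have "norm z > 0" using that Y by linarith
    moreover from this have "\<alpha> * norm z > 0" using \<alpha> by simp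
    ultimately have "1 \<le> ln (\<alpha> * norm z)" by (simp add: ln_ge_iff)
    moreover note \<open>norm z > 0\<close>
    ultimately have "1 \<le> ln \<alpha> + ln (norm z)" using \<alpha> by (simp add: ln_mult)
    moreover have "\<bar>Re (\<rho> (1 / z))\<bar> \<le> 1"
      using \<rho>1[OF that] abs_Re_le_cmod[of "\<rho> (1/z)"] by linarith
    ultimately show ?thesis by linarith
  qed
  have "eventually (\<lambda>x::real. ln \<alpha> + ln x + 1 \<le> x / 2) at_top"
    by real_asymp
  then obtain B1 where B1: "\<And>x. x \<ge> B1 \<Longrightarrow> ln \<alpha> + ln x + 1 \<le> x / 2"
    by (auto simp: eventually_at_top_linorder)
  \<comment> \<open>\<open>B1\<close> gives \<open>Re z \<le> norm z / 2\<close> and so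
    \<open>Im z \<ge> norm z / 2\<close>; \<open>2 * Y\<close> then puts \<open>z\<close> into the
    half plane of the contraction; the last entry forces the branch index of \<open>z\<close> to be
    at least \<open>N\<close>.\<close>
  define B where "B = Max {B1, 2 * Y, 4 * pi * N + 2 * pi + 2 + 2 * \<bar>b\<bar>}"
  have B: "B \<ge> B1" "B \<ge> 2 * Y" "B \<ge> 4 * pi * N + 2 * pi + 2 + 2 * \<bar>b\<bar>"
    by (auto simp: B_def)
  show ?thesis
  proof (rule that[of N Z B])
    show "N \<ge> 1" by (simp add: N_def)
    show "inj_on Z {N..}"
    proof (rule inj_onI)
      fix m n assume mn: "m \<in> {N..}" "n \<in> {N..}" "Z m = Z n"
      then have "T m (Z m) = T n (Z m)" using Z(2)[of m] Z(2)[of n] by simp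
      then have "of_real (2 * pi * m - b) = (of_real (2 * pi * n - b) :: complex)"
        by (simp add: T_def)
      then have "2 * pi * m - b = 2 * pi * n - b" by (simp only: of_real_eq_iff)
      then show "m = n" by simp
    qed
    fix n assume n: "n \<ge> N"
    have nY: "norm (Z n) \<ge> Y" using normY Z n by blast
    then have nz: "Z n \<noteq> 0" using Y by auto
    have "Re (Z n) = Re (T n (Z n))" using Z n by simp
    also have "\<dots> \<ge> 0" using Re_ln[OF nY] nz by (simp add: T_def)
    finally show "Z n = T n (Z n) \<and> Re (Z n) \<ge> 0 \<and> Im (Z n) \<ge> 1 \<and> norm (Z n) \<ge> B0 \<and> norm (\<rho> (1 / Z n)) \<le> 1"
      using Z[OF n] nY Y \<rho>1[OF nY] by auto
    have e1: "exp (of_real (ln \<alpha>)) = (of_real \<alpha> :: complex)"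
      using \<alpha> by (simp add: exp_of_real)
    have e2: "exp (\<i> * of_real (2 * pi * real n)) = (1::complex)"
      using exp_integer_2pi[of "of_nat n"] by (simp add: algebra_simps)
    have "exp (Z n) = exp (T n (Z n))" using Z n by simp
    also have "T n (Z n) = of_real (ln \<alpha>) + Ln (Z n) + (\<rho> (1 / Z n) - \<i> * of_real b) + \<i> * of_real (2 * pi * real n)"
      by (simp add: T_def algebra_simps)
    also have "exp \<dots> = of_real \<alpha> * Z n * exp (\<rho> (1 / Z n) - \<i> * of_real b)"
      by (simp only: exp_add e1 e2 exp_Ln[OF nz] mult_1_right)
    finally show "exp (Z n) = of_real \<alpha> * Z n * exp (\<rho> (1 / Z n) - \<i> * of_real b)" .
  next
    fix z assume z: "Re z \<ge> 0" "Im z \<ge> 0" "norm z \<ge> B"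
      and eq: "exp z = of_real \<alpha> * z * exp (\<rho> (1 / z) - \<i> * of_real b)"
    have nY: "norm z \<ge> Y" using z B Y by linarith
    then have nz: "z \<noteq> 0" using Y by auto
    have "exp z = exp (of_real (ln \<alpha>) + Ln z + (\<rho> (1 / z) - \<i> * of_real b))"
      by (subst eq) (simp only: exp_add exp_Ln[OF nz] exp_of_real exp_ln[OF \<alpha>])
    then obtain m :: int where
      m: "z = of_real (ln \<alpha>) + Ln z + (\<rho> (1 / z) - \<i> * of_real b) + (of_int (2 * m) * pi) * \<i>"
      unfolding exp_eq by blast
    have Rez: "Re z = ln \<alpha> + ln (norm z) + Re (\<rho> (1/z))"
      by (subst m) (use nz in simp)
    have Imz: "Im z = Im (Ln z) + Im (\<rho> (1/z)) - b + 2 * m * pi"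
      by (subst m) (use nz in simp)
    have "\<bar>Re (\<rho> (1 / z))\<bar> \<le> 1" "\<bar>Im (\<rho> (1 / z))\<bar> \<le> 1"
      using \<rho>1[OF nY] abs_Re_le_cmod[of "\<rho> (1/z)"] abs_Im_le_cmod[of "\<rho> (1/z)"] by linarith+
    note ab = this
    have "Re z \<le> norm z / 2" using Rez ab B1[of "norm z"] z B by linarith
    moreover have "norm z \<le> Re z + Im z" using cmod_le[of z] z by simp
    ultimately have Im: "Im z \<ge> norm z / 2" by linarith
    then have ImY: "Im z \<ge> Y" using z B by linarith
    have "Im (Ln z) \<le> pi" using nz by (simp add: Im_Ln_le_pi)
    then have "2 * m * pi \<ge> B / 2 - pi - 1 - \<bar>b\<bar>" using Imz ab Im z by linarith
    also have "B / 2 - pi - 1 - \<bar>b\<bar> \<ge> 2 * pi * N" using B by linarith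
    finally have "real_of_int m \<ge> real N" by (simp add: mult.commute)
    then have mN: "m \<ge> int N" by linarith
    then have nm: "nat m \<ge> N" "real (nat m) = of_int m" "complex_of_nat (nat m) = of_int m" by auto
    have "T (nat m) z = of_real (ln \<alpha>) + Ln z + (\<rho> (1 / z) - \<i> * of_real b) + (of_int (2 * m) * pi) * \<i>"
      by (simp add: T_def nm algebra_simps)
    also have "\<dots> = z" by (rule m[symmetric])
    finally have "z = Z (nat m)" using Z_unique nm ImY by blast
    then show "z \<in> Z ` {N..}" using nm by auto
  qed
qed

text \<open>Write \<open>Z = W + V\<close> with \<open>W = 2 pi i n\<close> and
  \<open>\<delta> = V / W\<close>. Then
  \<open>Ln Z = ln (2 pi n) + i pi / 2 + Ln (1 + \<delta>)\<close>, so \<open>V\<close> equals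
  \<open>L + i (pi / 2 - b)\<close> up to \<open>o(1)\<close>. Putting this into
  \<open>Ln (1 + \<delta>) = \<delta> + O(\<delta>^2)\<close> and using
  \<open>\<rho> (1 / Z) ~ C / W\<close> gives the term of order \<open>ln n / n\<close> and the
  terms of order \<open>1 / n\<close>.\<close>

lemma log_fixpoint_asymptotics:
  fixes \<alpha> b :: real and \<rho> :: "complex \<Rightarrow> complex" and C :: complex
  assumes \<alpha>: "\<alpha> > 0" and \<rho>: "\<rho> 0 = 0" "(\<rho> has_field_derivative C) (at 0)"
    and Z: "\<And>n. n \<ge> N \<Longrightarrow>
      Z n = of_real (ln \<alpha>) + Ln (Z n) + \<rho> (1 / Z n) + \<i> * of_real (2 * pi * real n - b)"
    and Z1: "\<And>n. n \<ge> N \<Longrightarrow> Im (Z n) \<ge> 1 \<and> norm (\<rho> (1 / Z n)) \<le> 1"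
  shows "(\<lambda>n. of_nat n * (Z n -
      (of_real (ln (2 * \<alpha> * pi * real n)) + \<i> * of_real (2 * pi * real n - b + pi / 2)
       + (of_real (ln (2 * \<alpha> * pi * real n)) + \<i> * of_real (pi / 2 - b) + C)
         / (2 * of_real pi * \<i> * of_nat n)))) \<longlonglongrightarrow> 0"
proof -
  define K where "K = \<bar>ln \<alpha>\<bar> + \<bar>b\<bar> + 1 + pi"
  have K: "K > 0" by (simp add: K_def add_nonneg_pos)
  define W where "W n = 2 * of_real pi * \<i> * (of_nat n :: complex)" for n :: nat
  define V where "V n = Z n - W n" for n
  define \<delta> where "\<delta> n = V n / W n" for n
  define \<Lambda> where "\<Lambda> n = Ln (1 + \<delta> n)" for n
  define R where "R n = \<rho> (1 / Z n)" for n
  define L where "L n = (of_real (ln (2 * \<alpha> * pi * real n)) :: complex)" for n :: nat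
  have normW: "norm (W n) = 2 * pi * n" for n
    by (simp add: W_def norm_mult)
  \<comment> \<open>A priori bound by absorption: \<open>norm V \<le> ln (norm Z) + K\<close> and
    \<open>ln x \<le> x / 2\<close> give \<open>norm Z \<le> 2 * norm W + 2 * K\<close>, and this is
    put back into the logarithm. \<open>K\<close> collects the constant, the phase, the bound 1 on
    \<open>\<rho>\<close> and the bound \<open>pi\<close> on the argument.\<close>
  have V_bound: "norm (V n) \<le> ln (4 * pi * n + 2 * K) + K" if n: "n \<ge> N" for n
  proof -
    have Zn: "norm (Z n) \<ge> 1" using Z1[OF n] abs_Im_le_cmod[of "Z n"] by linarith
    then have nz: "Z n \<noteq> 0" by auto
    have "norm (Ln (Z n)) \<le> \<bar>Re (Ln (Z n))\<bar> + \<bar>Im (Ln (Z n))\<bar>" by (rule cmod_le)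
    also have "\<bar>Im (Ln (Z n))\<bar> \<le> pi"
      using nz mpi_less_Im_Ln[of "Z n"] Im_Ln_le_pi[of "Z n"] by linarith
    also have "\<bar>Re (Ln (Z n))\<bar> = ln (norm (Z n))" using nz Zn by simp
    finally have 1: "norm (Ln (Z n)) \<le> ln (norm (Z n)) + pi" by simp
    have "V n = of_real (ln \<alpha>) + Ln (Z n) + R n - \<i> * of_real b"
      unfolding V_def by (subst Z[OF n]) (simp add: W_def R_def algebra_simps)
    also have "norm \<dots> \<le> \<bar>ln \<alpha>\<bar> + norm (Ln (Z n)) + norm (R n) + \<bar>b\<bar>"
      by (intro order_trans[OF norm_triangle_ineq4] add_mono order_trans[OF norm_triangle_ineq])
        (auto simp: norm_mult)
    also have "\<dots> \<le> ln (norm (Z n)) + K"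
      using 1 Z1[OF n] by (simp add: K_def R_def)
    finally have 2: "norm (V n) \<le> ln (norm (Z n)) + K" .
    have "ln (norm (Z n) / 2) \<le> norm (Z n) / 2 - 1"
      using Zn by (intro ln_le_minus_one) auto
    moreover have "ln (norm (Z n) / 2) = ln (norm (Z n)) - ln 2"
      using nz by (simp add: ln_div)
    ultimately have "ln (norm (Z n)) \<le> norm (Z n) / 2"
      using ln_2_less_1 by linarith
    moreover have "norm (Z n) \<le> norm (W n) + norm (V n)"
      using norm_triangle_ineq[of "W n" "V n"] by (simp add: V_def)
    ultimately have "norm (Z n) \<le> 4 * pi * n + 2 * K"
      using 2 normW[of n] by linarith
    then have "ln (norm (Z n)) \<le> ln (4 * pi * n + 2 * K)"
      using Zn by (subst ln_le_cancel_iff) auto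
    with 2 show ?thesis by simp
  qed
  have \<delta>_bound: "norm (\<delta> n) \<le> (ln (4 * pi * n + 2 * K) + K) / (2 * pi * n)" if "n \<ge> N" for n
    using V_bound[OF that] by (simp add: \<delta>_def norm_divide normW divide_right_mono)
  have ev: "eventually (\<lambda>n. n \<ge> N \<and> n > 0) sequentially"
    by (intro eventually_conj eventually_ge_at_top eventually_gt_at_top)
  have \<delta>0: "\<delta> \<longlonglongrightarrow> 0"
  proof (rule Lim_null_comparison)
    show "eventually (\<lambda>n. norm (\<delta> n) \<le> (ln (4 * pi * n + 2 * K) + K) / (2 * pi * n)) sequentially"
      using ev by eventually_elim (use \<delta>_bound in auto)
    show "(\<lambda>n. (ln (4 * pi * real n + 2 * K) + K) / (2 * pi * n)) \<longlonglongrightarrow> 0"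
      using K by real_asymp
  qed
  have \<delta>_small: "eventually (\<lambda>n. norm (\<delta> n) < 1/2) sequentially"
    using tendstoD[OF \<delta>0, of "1/2"] by (simp only: dist_norm diff_zero)
  \<comment> \<open>The quadratic error is harmless because \<open>n * \<delta>^2\<close> is of
    order \<open>(ln n)^2 / n\<close>.\<close>
  have n\<Lambda>: "(\<lambda>n. of_nat n * (\<Lambda> n - \<delta> n)) \<longlonglongrightarrow> 0"
  proof (rule Lim_null_comparison)
    show "eventually (\<lambda>n. norm (of_nat n * (\<Lambda> n - \<delta> n)) \<le>
        real n * (2 * ((ln (4 * pi * n + 2 * K) + K) / (2 * pi * n))\<^sup>2)) sequentially"
      using ev \<delta>_small
    proof eventually_elim
      case (elim n)
      have "norm (\<Lambda> n - \<delta> n) \<le> (norm (\<delta> n))\<^sup>2 / (1 - norm (\<delta> n))"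
        unfolding \<Lambda>_def by (rule Ln_approx_linear) (use elim in auto)
      also have "\<dots> \<le> (norm (\<delta> n))\<^sup>2 / (1/2)"
        using elim by (intro divide_left_mono) auto
      also have "\<dots> = 2 * (norm (\<delta> n))\<^sup>2" by simp
      also have "\<dots> \<le> 2 * ((ln (4 * pi * n + 2 * K) + K) / (2 * pi * n))\<^sup>2"
        using \<delta>_bound[of n] elim by (intro mult_left_mono power_mono) auto
      finally show ?case by (simp add: norm_mult mult_left_mono)
    qed
    show "(\<lambda>n. real n * (2 * ((ln (4 * pi * real n + 2 * K) + K) / (2 * pi * n))\<^sup>2)) \<longlonglongrightarrow> 0"
      using K by real_asymp
  qed
  have \<Lambda>0: "\<Lambda> \<longlonglongrightarrow> 0"
  proof -
    have "(\<lambda>n. Ln (1 + \<delta> n)) \<longlonglongrightarrow> Ln (1 + 0)"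
      by (intro tendsto_intros \<delta>0) auto
    then show ?thesis by (simp add: \<Lambda>_def[abs_def])
  qed
  have Z_eq: "Z n = W n * (1 + \<delta> n)" if "n > 0" for n
    using that by (simp add: V_def \<delta>_def W_def field_simps)
  have nZ: "(\<lambda>n. of_nat n / Z n) \<longlonglongrightarrow> 1 / (2 * of_real pi * \<i>)"
  proof (rule Lim_transform_eventually)
    show "(\<lambda>n. 1 / (2 * of_real pi * \<i> * (1 + \<delta> n))) \<longlonglongrightarrow> 1 / (2 * of_real pi * \<i>)"
      by (rule tendsto_eq_intros \<delta>0 refl | simp)+
    show "eventually (\<lambda>n. 1 / (2 * of_real pi * \<i> * (1 + \<delta> n)) = of_nat n / Z n) sequentially"
      using ev by eventually_elim (simp add: Z_eq, simp add: W_def)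
  qed
  have Z_nz: "eventually (\<lambda>n. Z n \<noteq> 0) sequentially"
    using ev by eventually_elim (use Z1 in force)
  have u: "filterlim (\<lambda>n. 1 / Z n) (at 0) sequentially"
  proof (rule filterlim_atI)
    have "(\<lambda>n. (of_nat n / Z n) * (1 / of_nat n)) \<longlonglongrightarrow> 1 / (2 * of_real pi * \<i>) * 0"
      by (intro tendsto_mult nZ lim_1_over_n)
    moreover have "eventually (\<lambda>n. (of_nat n / Z n) * (1 / of_nat n) = 1 / Z n) sequentially"
      using ev by eventually_elim simp
    ultimately show "(\<lambda>n. 1 / Z n) \<longlonglongrightarrow> 0"
      using Lim_transform_eventually by fastforce
    show "eventually (\<lambda>n. 1 / Z n \<noteq> 0) sequentially"
      using Z_nz by eventually_elim simp
  qed
  have Rlim: "(\<lambda>n. Z n * R n) \<longlonglongrightarrow> C"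
  proof -
    have "((\<lambda>x. \<rho> x / x) \<longlongrightarrow> C) (at 0)"
      using \<rho> by (simp add: DERIV_def)
    from filterlim_compose[OF this u] show ?thesis by (simp add: R_def mult.commute)
  qed
  have nR: "(\<lambda>n. of_nat n * R n) \<longlonglongrightarrow> C / (2 * of_real pi * \<i>)"
  proof -
    have "(\<lambda>n. (of_nat n / Z n) * (Z n * R n)) \<longlonglongrightarrow> 1 / (2 * of_real pi * \<i>) * C"
      by (intro tendsto_mult nZ Rlim)
    moreover have "eventually (\<lambda>n. (of_nat n / Z n) * (Z n * R n) = of_nat n * R n) sequentially"
      using Z_nz by eventually_elim simp
    ultimately show ?thesis using Lim_transform_eventually by fastforce
  qed
  have R0: "R \<longlonglongrightarrow> 0"
  proof -
    have "isCont \<rho> 0" using \<rho>(2) by (rule DERIV_isCont)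
    then have "(\<rho> \<longlongrightarrow> 0) (at 0)" using \<rho>(1) by (simp add: isCont_def)
    from filterlim_compose[OF this u] show ?thesis by (simp add: R_def[abs_def])
  qed
  have V_eq: "eventually (\<lambda>n. V n = L n + \<i> * of_real (pi / 2 - b) + (\<Lambda> n + R n)) sequentially"
    using ev \<delta>_small
  proof eventually_elim
    case (elim n)
    have pos: "2 * pi * real n > 0" using elim by simp
    \<comment> \<open>With \<open>1 + \<delta> n\<close> in the right half plane, multiplication by
      \<open>\<i>\<close> does not cross the cut and adds exactly \<open>pi / 2\<close> to the
      argument.\<close>
    have "\<bar>Re (\<delta> n)\<bar> < 1/2" using abs_Re_le_cmod[of "\<delta> n"] elim by linarith
    then have Re: "Re (1 + \<delta> n) > 0" by simp
    then have nz: "1 + \<delta> n \<noteq> 0" by (metis less_irrefl zero_complex.simps(1))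
    have "Z n = of_real (2 * pi * n) * (\<i> * (1 + \<delta> n))"
      using elim by (subst Z_eq) (auto simp: W_def)
    also have "Ln \<dots> = of_real (ln (2 * pi * n)) + Ln (\<i> * (1 + \<delta> n))"
      using Ln_times_of_real[OF pos, of "\<i> * (1 + \<delta> n)"] nz Ln_of_real[OF pos] by (simp del: of_real_mult)
    also have "Ln (\<i> * (1 + \<delta> n)) = \<Lambda> n + \<i> * of_real pi / 2"
      using Re nz by (subst Ln_times_ii) (auto simp: \<Lambda>_def)
    finally have Ln: "Ln (Z n) = of_real (ln (2 * pi * n)) + (\<Lambda> n + \<i> * of_real pi / 2)" .
    have Leq: "L n = of_real (ln \<alpha>) + of_real (ln (2 * pi * n))"
      using \<alpha> elim by (simp add: L_def ln_mult)
    have "V n = of_real (ln \<alpha>) + Ln (Z n) + R n - \<i> * of_real b"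
      unfolding V_def using elim by (subst Z) (auto simp: W_def R_def algebra_simps)
    then show ?case unfolding Ln Leq by (simp add: algebra_simps)
  qed
  \<comment> \<open>The scaled error splits exactly into three null sequences: the linearisation of
    the logarithm, the part \<open>\<Lambda> + R\<close> of \<open>V\<close> inside
    \<open>n * \<delta> = V / (2 pi i)\<close>, and the error in \<open>n * R\<close>.\<close>
  have "(\<lambda>n. of_nat n * (\<Lambda> n - \<delta> n) + (\<Lambda> n + R n) / (2 * of_real pi * \<i>)
          + (of_nat n * R n - C / (2 * of_real pi * \<i>)))
        \<longlonglongrightarrow> 0 + (0 + 0) / (2 * of_real pi * \<i>) + (C / (2 * of_real pi * \<i>) - C / (2 * of_real pi * \<i>))"
    by (intro tendsto_intros n\<Lambda> \<Lambda>0 R0 nR) auto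
  then have "(\<lambda>n. of_nat n * (\<Lambda> n - \<delta> n) + (\<Lambda> n + R n) / (2 * of_real pi * \<i>)
          + (of_nat n * R n - C / (2 * of_real pi * \<i>))) \<longlonglongrightarrow> 0" by simp
  moreover have "eventually (\<lambda>n. of_nat n * (\<Lambda> n - \<delta> n) + (\<Lambda> n + R n) / (2 * of_real pi * \<i>)
          + (of_nat n * R n - C / (2 * of_real pi * \<i>)) = of_nat n * (Z n -
      (L n + \<i> * of_real (2 * pi * real n - b + pi / 2)
       + (L n + \<i> * of_real (pi / 2 - b) + C) / (2 * of_real pi * \<i> * of_nat n)))) sequentially"
    using ev V_eq
  proof eventually_elim
    case (elim n)
    define s where "s = \<i> * complex_of_real (pi / 2 - b)"
    have nW: "W n \<noteq> 0" using elim by (auto simp: W_def)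
    have Zn: "Z n = W n + (L n + s + (\<Lambda> n + R n))"
      using elim by (simp add: V_def s_def algebra_simps)
    have dn: "\<delta> n = (L n + s + (\<Lambda> n + R n)) / W n"
      using elim by (simp add: \<delta>_def s_def)
    have ii: "\<i> * of_real (2 * pi * real n - b + pi / 2) = W n + s"
      by (simp add: W_def s_def algebra_simps)
    have t: "x / (2 * of_real pi * \<i>) = of_nat n * (x / W n)" for x
      using elim by (simp add: W_def)
    show ?case
      unfolding ii s_def[symmetric] W_def[symmetric] unfolding Zn dn t
      by (simp add: algebra_simps add_divide_distrib)
  qed
  ultimately show ?thesis
    unfolding L_def by (rule Lim_transform_eventually)
qed

section \<open>The dispersion relations at large wavenumbers\<close>

text \<open>Splitting off the argument of \<open>sinh\<close> lets its zero at
  \<open>\<sigma> = 0\<close> cancel against that of \<open>1 - sl st\<close>; the value 1 removes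
  the singularity.\<close>

definition sinhc :: "complex \<Rightarrow> complex" where
  "sinhc y = (if y = 0 then 1 else sinh y / y)"

lemma sinhc_0 [simp]: "sinhc 0 = 1"
  by (simp add: sinhc_def)

lemma sinh_eq_mult_sinhc: "sinh y = y * sinhc y"
  by (simp add: sinhc_def)

lemma has_field_derivative_sinh_complex:
  "(sinh has_field_derivative cosh z) (at (z::complex))"
  using has_field_derivative_sinh[of "\<lambda>x. x" 1 z UNIV] by simp

lemma holomorphic_sinhc: "sinhc holomorphic_on UNIV"
proof -
  have "(sinh :: complex \<Rightarrow> complex) holomorphic_on UNIV"
    using has_field_derivative_sinh_complex
    by (auto simp: holomorphic_on_open)
  from pole_lemma_open[OF this open_UNIV, of 0]
  have "(\<lambda>z::complex. if z = 0 then deriv sinh 0 else (sinh z - sinh 0) / (z - 0)) holomorphic_on UNIV" .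
  moreover have "deriv sinh (0::complex) = 1"
    using DERIV_imp_deriv[OF has_field_derivative_sinh_complex[of 0]] by simp
  ultimately show ?thesis by (simp add: sinhc_def[abs_def] cong: if_cong)
qed

lemma analytic_on_sinhc [analytic_intros]:
  assumes "f analytic_on A"
  shows "(\<lambda>x. sinhc (f x)) analytic_on A"
proof -
  have "sinhc analytic_on UNIV"
    using holomorphic_sinhc by (simp add: analytic_on_open)
  from analytic_on_compose_gen[OF assms this] show ?thesis by (simp add: o_def)
qed

text \<open>Serves to discard the first-order terms of all coefficients that are even in
  \<open>1/k\<close>.\<close>

lemma deriv_even_0:
  fixes f :: "complex \<Rightarrow> complex"
  assumes "(f has_field_derivative D) (at 0)" "\<And>x. f (- x) = f x"
  shows "D = 0"
proof -
  have "((\<lambda>x. f (- x)) has_field_derivative D * (- 1)) (at 0)"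
    by (rule DERIV_chain2[where g = uminus]) (use assms(1) in \<open>auto intro!: derivative_eq_intros\<close>)
  then have "(f has_field_derivative - D) (at 0)" by (simp add: assms(2))
  from DERIV_unique[OF assms(1) this] show ?thesis by simp
qed

lemma has_field_derivative_sinhc_0: "(sinhc has_field_derivative 0) (at 0)"
proof -
  have "(sinhc has_field_derivative deriv sinhc 0) (at 0)"
    using holomorphic_sinhc by (intro holomorphic_derivI) auto
  with deriv_even_0[OF this] show ?thesis by (simp add: sinhc_def)
qed

text \<open>The equation is quadratic in \<open>exp w\<close>, and its roots have product -1.
  \<open>S\<close> may be either square root of \<open>A\<^sup>2 + 1\<close>, which leaves room to
  take the one close to \<open>A\<close>.\<close>

lemma sinh_eq_iff_exp:
  fixes w A S \<epsilon> :: complex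
  assumes "S\<^sup>2 = A\<^sup>2 + 1" "\<epsilon>\<^sup>2 = 1"
  shows "sinh w = \<epsilon> * A \<longleftrightarrow> exp w = \<epsilon> * (A + S) \<or> exp w = - \<epsilon> / (A + S)"
proof -
  have 1: "(A + S) * (S - A) = 1"
    using assms by (simp add: algebra_simps power2_eq_square)
  then have nz: "A + S \<noteq> 0" by auto
  have inv: "1 / (A + S) = S - A" using 1 nz by (simp add: field_simps)
  have "sinh w = \<epsilon> * A \<longleftrightarrow> exp w * exp w - 1 = 2 * \<epsilon> * A * exp w"
    by (auto simp: sinh_field_def exp_minus field_simps)
  also have "\<dots> \<longleftrightarrow> (exp w - \<epsilon> * (A + S)) * (exp w + \<epsilon> * (S - A)) = 0"
  proof -
    have "(exp w - \<epsilon> * (A + S)) * (exp w + \<epsilon> * (S - A))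
        = exp w * exp w - 2 * \<epsilon> * A * exp w - \<epsilon>\<^sup>2 * ((A + S) * (S - A))"
      by (simp add: algebra_simps power2_eq_square)
    also have "\<dots> = exp w * exp w - 1 - 2 * \<epsilon> * A * exp w" using 1 assms by simp
    finally show ?thesis by auto
  qed
  also have "\<epsilon> * (S - A) = - (- \<epsilon> / (A + S))" using inv by (simp add: divide_simps nz)
  finally show ?thesis by (simp add: eq_neg_iff_add_eq_0)
qed

lemma hyperbolic_product_to_sum:
  fixes x y s :: complex
  shows "2 * (sinh x * cosh y - s * (sinh y * cosh x)) = (1 - s) * sinh (y + x) - (1 + s) * sinh (y - x)"
  by (simp add: sinh_add sinh_diff algebra_simps)

text \<open>The terms \<open>p * sin (p * h)\<close>, \<open>cos (p * h)\<close> and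
  \<open>cos (q * h)\<close> are even in \<open>p\<close> and \<open>q\<close>, while
  \<open>q\<close> and \<open>sin (q * h)\<close> change sign together; a wrong root therefore only
  flips the sign of the whole left-hand side. Leaving \<open>sp\<close> and \<open>sq\<close>
  abstract allows the antisymmetric relation to be read off by exchanging them.\<close>

lemma dispersion_hyperbolic:
  fixes k p q h sp sq :: complex
  assumes "k \<noteq> 0" "p\<^sup>2 = (\<i> * k * sp)\<^sup>2" "q\<^sup>2 = (\<i> * k * sq)\<^sup>2"
  shows "k\<^sup>2 * sin (q * h) * cos (p * h) + p * q * sin (p * h) * cos (q * h) = 0 \<longleftrightarrow>
    (1 - sp * sq) * sinh (k * h * (sp + sq)) = (1 + sp * sq) * sinh (k * h * (sp - sq))"
proof -
  define x where "x = k * h * sq"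
  define y where "y = k * h * sp"
  have si: "sin (\<i> * k * s * h) = \<i> * sinh (k * h * s)" "cos (\<i> * k * s * h) = cosh (k * h * s)" for s
    by (simp_all add: sinh_conv_sin cosh_conv_cos mult_ac)
  have p: "p = \<i> * k * sp \<or> p = - (\<i> * k * sp)" and q: "q = \<i> * k * sq \<or> q = - (\<i> * k * sq)"
    using assms by (simp_all only: power2_eq_iff)
  have P: "p * sin (p * h) = \<i> * k * sp * (\<i> * sinh y)" "cos (p * h) = cosh y"
    using p by (elim disjE; simp add: si y_def)+
  have Q: "cos (q * h) = cosh x"
    using q by (elim disjE; simp add: si x_def)
  have Q': "q = \<i> * k * sq \<and> sin (q * h) = \<i> * sinh x \<or> q = - (\<i> * k * sq) \<and> sin (q * h) = - (\<i> * sinh x)"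
    using q by (elim disjE; simp add: si x_def)
  have "k\<^sup>2 * sin (q * h) * cos (p * h) + p * q * sin (p * h) * cos (q * h)
     = k\<^sup>2 * sin (q * h) * cosh y + q * (\<i> * k * sp * (\<i> * sinh y)) * cosh x"
    unfolding P(1)[symmetric] P(2) Q by (simp add: mult_ac)
  with Q' have "k\<^sup>2 * sin (q * h) * cos (p * h) + p * q * sin (p * h) * cos (q * h)
     = \<i> * k\<^sup>2 * (sinh x * cosh y - (sp * sq) * (sinh y * cosh x)) \<or>
     k\<^sup>2 * sin (q * h) * cos (p * h) + p * q * sin (p * h) * cos (q * h)
     = - (\<i> * k\<^sup>2 * (sinh x * cosh y - (sp * sq) * (sinh y * cosh x)))"
    by (elim disjE conjE) (simp_all add: power2_eq_square algebra_simps)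
  then have "k\<^sup>2 * sin (q * h) * cos (p * h) + p * q * sin (p * h) * cos (q * h) = 0 \<longleftrightarrow>
     2 * (sinh x * cosh y - (sp * sq) * (sinh y * cosh x)) = 0"
    using assms(1) by auto
  also have "\<dots> \<longleftrightarrow> (1 - sp * sq) * sinh (y + x) = (1 + sp * sq) * sinh (y - x)"
    unfolding hyperbolic_product_to_sum by simp
  finally show ?thesis by (simp add: x_def y_def algebra_simps)
qed

section \<open>Coefficients of the plate as analytic functions of the reciprocal wavenumber\<close>

locale clamped_plate =
  fixes h kt kl :: real
  assumes h: "h > 0" and kt: "kt > kl" and kl: "kl > 0"
begin

definition \<alpha> :: real where "\<alpha> = 2 * ((kt\<^sup>2 - kl\<^sup>2) / (kl\<^sup>2 + kt\<^sup>2))"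

text \<open>
  Everything is expressed in \<open>\<sigma> = 1 / k\<close>, in which the coefficients are analytic at \<open>0\<close>.
  Up to signs, \<open>p = i k sl(1/k)\<close> and \<open>q = i k st(1/k)\<close>.
\<close>

definition sl :: "complex \<Rightarrow> complex" where "sl \<sigma> = csqrt (1 - (of_real kl * \<sigma>)\<^sup>2)"
definition st :: "complex \<Rightarrow> complex" where "st \<sigma> = csqrt (1 - (of_real kt * \<sigma>)\<^sup>2)"

text \<open>
  With \<open>w = k h (sl + st)\<close> and \<open>A = \<alpha> h k ampl\<close> the two dispersion relations become \<open>sinh w = A\<close> and
  \<open>sinh w = - A\<close>.  Their roots \<open>exp w\<close> of large modulus are \<open>\<plusminus> (A + sqrt (A\<^sup>2 + 1)) = \<plusminus> 2 \<alpha> h k corr\<close>,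
  and \<open>phase_shift = 2 h k - w\<close>.
\<close>

definition ampl :: "complex \<Rightarrow> complex" where
  "ampl \<sigma> = (1 + sl \<sigma> * st \<sigma>)\<^sup>2 * (of_real kl ^ 2 + of_real kt ^ 2)
     / (2 * (of_real kl ^ 2 + of_real kt ^ 2 - (of_real kl * of_real kt * \<sigma>)\<^sup>2) * (sl \<sigma> + st \<sigma>))
     * sinhc (of_real h * \<sigma> * (of_real kt ^ 2 - of_real kl ^ 2) / (sl \<sigma> + st \<sigma>))"

definition corr :: "complex \<Rightarrow> complex" where
  "corr \<sigma> = ampl \<sigma> * (1 + csqrt (1 + (\<sigma> / (of_real (\<alpha> * h) * ampl \<sigma>))\<^sup>2)) / 2"

definition phase_shift :: "complex \<Rightarrow> complex" where
  "phase_shift \<sigma> = of_real h * \<sigma> * (of_real kl ^ 2 / (1 + sl \<sigma>) + of_real kt ^ 2 / (1 + st \<sigma>))"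

text \<open>Collects every deviation from \<open>exp z = \<epsilon> \<alpha> z\<close>; after the
  rescaling \<open>\<sigma> = 2 h / z\<close> it is the perturbation \<open>\<rho>\<close>.\<close>

definition log_corr :: "complex \<Rightarrow> complex" where
  "log_corr \<sigma> = phase_shift \<sigma> + Ln (corr \<sigma>)"

lemma \<alpha>_pos: "\<alpha> > 0"
proof -
  have "kl\<^sup>2 < kt\<^sup>2" using kt kl by (intro power_strict_mono) auto
  moreover have "0 < kl\<^sup>2 + kt\<^sup>2" using kl by (intro add_pos_nonneg) auto
  ultimately show ?thesis by (simp add: \<alpha>_def del: zero_less_mult_iff)
qed

lemma sq_sum_nz: "(of_real kl :: complex)\<^sup>2 + (of_real kt)\<^sup>2 \<noteq> 0"
proof -
  have "kl\<^sup>2 + kt\<^sup>2 > 0" using kl by (intro add_pos_nonneg) auto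
  then have "complex_of_real (kl\<^sup>2 + kt\<^sup>2) \<noteq> 0" by (simp only: of_real_eq_0_iff)
  then show ?thesis by simp
qed

lemma four_sq_sum_nz: "4 * (of_real kl :: complex)\<^sup>2 + 4 * (of_real kt)\<^sup>2 \<noteq> 0"
proof
  assume "4 * (of_real kl :: complex)\<^sup>2 + 4 * (of_real kt)\<^sup>2 = 0"
  then have "4 * ((of_real kl :: complex)\<^sup>2 + (of_real kt)\<^sup>2) = 0" by (simp only: distrib_left)
  with sq_sum_nz show False by (metis mult_eq_0_iff zero_neq_numeral)
qed

lemma coeffs_at_0 [simp]: "sl 0 = 1" "st 0 = 1" "ampl 0 = 1" "corr 0 = 1" "phase_shift 0 = 0" "log_corr 0 = 0"
  by (simp_all add: sq_sum_nz four_sq_sum_nz sl_def st_def ampl_def corr_def phase_shift_def log_corr_def)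

lemma analytic_sl: "sl analytic_on {0}"
  unfolding sl_def[abs_def] by (intro analytic_intros) auto

lemma analytic_st: "st analytic_on {0}"
  unfolding st_def[abs_def] by (intro analytic_intros) auto

lemma analytic_ampl: "ampl analytic_on {0}"
  unfolding ampl_def[abs_def]
  by (intro analytic_intros analytic_sl analytic_st) (use sq_sum_nz four_sq_sum_nz in auto)

lemma analytic_corr: "corr analytic_on {0}"
  unfolding corr_def[abs_def]
  by (intro analytic_intros analytic_ampl) (use \<alpha>_pos h in auto)

lemma analytic_phase_shift: "phase_shift analytic_on {0}"
  unfolding phase_shift_def[abs_def]
  by (intro analytic_intros analytic_sl analytic_st) auto

lemma analytic_log_corr: "log_corr analytic_on {0}"
  unfolding log_corr_def[abs_def]
  by (intro analytic_intros analytic_phase_shift analytic_corr) auto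

lemma even_coeffs: "sl (- \<sigma>) = sl \<sigma>" "st (- \<sigma>) = st \<sigma>" "ampl (- \<sigma>) = ampl \<sigma>" "corr (- \<sigma>) = corr \<sigma>"
proof -
  show s: "sl (- \<sigma>) = sl \<sigma>" "st (- \<sigma>) = st \<sigma>" by (simp_all add: sl_def st_def)
  have sinhc: "sinhc (- y) = sinhc y" for y by (simp add: sinhc_def)
  show a: "ampl (- \<sigma>) = ampl \<sigma>" by (simp add: ampl_def s sinhc)
  show "corr (- \<sigma>) = corr \<sigma>" by (simp add: corr_def a)
qed

text \<open>\<open>sl\<close>, \<open>st\<close> and \<open>corr\<close> are even, so only the
  explicit factor \<open>\<sigma>\<close> of \<open>phase_shift\<close> contributes, with
  coefficient \<open>h * (kl\<^sup>2 / 2 + kt\<^sup>2 / 2)\<close>.\<close>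

lemma has_field_derivative_log_corr_0:
  "(log_corr has_field_derivative of_real (h * (kl\<^sup>2 + kt\<^sup>2) / 2)) (at 0)"
proof -
  have D: "(f has_field_derivative deriv f 0) (at 0)" if "f analytic_on {0}" for f :: "complex \<Rightarrow> complex"
    unfolding DERIV_deriv_iff_field_differentiable
    using that by (rule analytic_on_imp_differentiable_at) simp
  have D0: "(f has_field_derivative 0) (at 0)"
    if "f analytic_on {0}" "\<And>\<sigma>. f (- \<sigma>) = f \<sigma>" for f :: "complex \<Rightarrow> complex"
    using D[OF that(1)] deriv_even_0[OF D[OF that(1)] that(2)] by simp
  have sl': "(sl has_field_derivative 0) (at 0)" by (rule D0[OF analytic_sl even_coeffs(1)])
  have st': "(st has_field_derivative 0) (at 0)" by (rule D0[OF analytic_st even_coeffs(2)])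
  have corr': "(corr has_field_derivative 0) (at 0)" by (rule D0[OF analytic_corr even_coeffs(4)])
  show ?thesis
    unfolding log_corr_def[abs_def] phase_shift_def[abs_def]
    by (rule derivative_eq_intros sl' st' corr' refl | simp add: field_simps)+
qed

lemma csqrt_sq: "(sl \<sigma>)\<^sup>2 = 1 - (of_real kl * \<sigma>)\<^sup>2" "(st \<sigma>)\<^sup>2 = 1 - (of_real kt * \<sigma>)\<^sup>2"
  by (simp_all add: sl_def st_def)

text \<open>This explains the formula for \<open>ampl\<close>. Both small quantities are
  rationalised: \<open>(1 - s t) (1 + s t) = \<sigma>^2 c\<close> and
  \<open>(s - t) (s + t) = \<sigma>^2 (kt^2 - kl^2)\<close>. The powers of \<open>\<sigma>\<close>
  then cancel against \<open>k\<close>, and \<open>\<alpha>\<close> normalises the value at 0 to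
  1.\<close>

lemma ampl_eq:
  fixes k \<sigma> :: complex
  assumes "k * \<sigma> = 1" "sl \<sigma> + st \<sigma> \<noteq> 0"
    and "of_real kl ^ 2 + of_real kt ^ 2 - (of_real kl * of_real kt * \<sigma>)\<^sup>2 \<noteq> 0"
  shows "(1 - sl \<sigma> * st \<sigma>) * (of_real (\<alpha> * h) * k * ampl \<sigma>)
    = (1 + sl \<sigma> * st \<sigma>) * sinh (k * of_real h * (sl \<sigma> - st \<sigma>))"
proof -
  define a b H :: complex where "a = of_real kl" "b = of_real kt" "H = of_real h"
  define s t where "s = sl \<sigma>" and "t = st \<sigma>"
  define c where "c = a\<^sup>2 + b\<^sup>2 - (a * b * \<sigma>)\<^sup>2"
  define y where "y = H * \<sigma> * (b\<^sup>2 - a\<^sup>2) / (s + t)"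
  have c: "c \<noteq> 0" using assms(3) by (simp add: c_def a_b_H_def)
  have st: "s + t \<noteq> 0" using assms(2) by (simp add: s_def t_def)
  have sq: "s\<^sup>2 = 1 - (a * \<sigma>)\<^sup>2" "t\<^sup>2 = 1 - (b * \<sigma>)\<^sup>2"
    by (simp_all add: s_def t_def csqrt_sq a_b_H_def)
  have s_t: "(s - t) * (s + t) = \<sigma>\<^sup>2 * (b\<^sup>2 - a\<^sup>2)"
  proof -
    have "(s - t) * (s + t) = s\<^sup>2 - t\<^sup>2" by (simp add: algebra_simps power2_eq_square)
    also have "\<dots> = \<sigma>\<^sup>2 * (b\<^sup>2 - a\<^sup>2)" unfolding sq by (simp add: algebra_simps power_mult_distrib)
    finally show ?thesis .
  qed
  have "k * H * ((s - t) * (s + t)) = (k * \<sigma>) * (H * \<sigma> * (b\<^sup>2 - a\<^sup>2))"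
    unfolding s_t by (simp add: power2_eq_square)
  then have "k * H * (s - t) * (s + t) = H * \<sigma> * (b\<^sup>2 - a\<^sup>2)"
    using assms(1) by (simp add: mult.assoc)
  then have y: "k * H * (s - t) = y"
    using st by (simp add: y_def eq_divide_eq)
  have "(1 - s * t) * (1 + s * t) = 1 - s\<^sup>2 * t\<^sup>2" by (simp add: algebra_simps power2_eq_square)
  also have "\<dots> = \<sigma>\<^sup>2 * c" unfolding sq c_def by (simp add: algebra_simps power2_eq_square)
  finally have ss: "(1 - s * t) * (1 + s * t) = \<sigma>\<^sup>2 * c" .
  have \<alpha>: "of_real \<alpha> * (a\<^sup>2 + b\<^sup>2) = 2 * (b\<^sup>2 - a\<^sup>2)"
    using sq_sum_nz by (simp add: \<alpha>_def a_b_H_def field_simps)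
  have st2: "s * 2 + t * 2 \<noteq> 0"
    using st by (metis distrib_right mult_eq_0_iff zero_neq_numeral)
  define u where "u = sinhc y"
  have "(1 - s * t) * (of_real \<alpha> * H * k * ((1 + s * t)\<^sup>2 * (a\<^sup>2 + b\<^sup>2) / (2 * c * (s + t)) * u))
     = ((1 - s * t) * (1 + s * t)) * (1 + s * t) * H * k * (of_real \<alpha> * (a\<^sup>2 + b\<^sup>2)) / (2 * c * (s + t)) * u"
    by (simp add: power2_eq_square)
  also have "\<dots> = (k * \<sigma>) * (1 + s * t) * y * u"
    unfolding ss \<alpha> y_def using c st st2 by (simp add: divide_simps) (simp add: algebra_simps power2_eq_square)
  also have "\<dots> = (1 + s * t) * sinh y"
    using assms(1) by (simp add: sinh_eq_mult_sinhc[of y] u_def mult.assoc)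
  finally have main: "(1 - s * t) * (of_real \<alpha> * H * k * ((1 + s * t)\<^sup>2 * (a\<^sup>2 + b\<^sup>2) / (2 * c * (s + t)) * u))
     = (1 + s * t) * sinh y" .
  have P: "ampl \<sigma> = (1 + s * t)\<^sup>2 * (a\<^sup>2 + b\<^sup>2) / (2 * c * (s + t)) * u"
    by (simp add: u_def ampl_def s_def t_def c_def y_def a_b_H_def)
  show ?thesis
    using main unfolding P[symmetric] y[symmetric]
    by (simp add: s_def t_def a_b_H_def mult.assoc)
qed

text \<open>Rationalising \<open>k * (1 - s)\<close> to
  \<open>\<sigma> * a\<^sup>2 / (1 + s)\<close> turns a large factor times a small difference into a
  term analytic at \<open>\<sigma> = 0\<close>.\<close>

lemma phase_eq:
  fixes k \<sigma> :: complex
  assumes "k * \<sigma> = 1" "1 + sl \<sigma> \<noteq> 0" "1 + st \<sigma> \<noteq> 0"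
  shows "k * of_real h * (sl \<sigma> + st \<sigma>) = 2 * of_real h * k - phase_shift \<sigma>"
proof -
  have aux: "k * (1 - s) = \<sigma> * (of_real a ^ 2 / (1 + s))"
    if "s\<^sup>2 = 1 - (of_real a * \<sigma>)\<^sup>2" "1 + s \<noteq> 0" for s :: complex and a :: real
  proof -
    have "k * (1 - s) * (1 + s) = k * (1 - s\<^sup>2)" by (simp add: algebra_simps power2_eq_square)
    also have "\<dots> = (k * \<sigma>) * \<sigma> * of_real a ^ 2" unfolding that(1) by (simp add: power2_eq_square)
    finally show ?thesis using that(2) assms(1) by (simp add: eq_divide_eq)
  qed
  have "2 * of_real h * k - k * of_real h * (sl \<sigma> + st \<sigma>) = of_real h * (k * (1 - sl \<sigma>) + k * (1 - st \<sigma>))"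
    by (simp add: algebra_simps)
  also have "\<dots> = phase_shift \<sigma>"
    unfolding aux[OF csqrt_sq(1) assms(2)] aux[OF csqrt_sq(2) assms(3)]
    by (simp add: phase_shift_def distrib_left mult.assoc)
  finally show ?thesis by (simp add: algebra_simps)
qed

text \<open>All conditions are open and hold at 0. The last one, multiplied by
  \<open>norm k\<close>, says that \<open>norm (A + S) > exp 1\<close>; together with the bound on
  \<open>phase_shift\<close> it excludes the small root.\<close>

lemma eventually_near_0:
  "eventually (\<lambda>\<sigma>. 1 + sl \<sigma> \<noteq> 0 \<and> 1 + st \<sigma> \<noteq> 0 \<and> sl \<sigma> + st \<sigma> \<noteq> 0 \<and> 1 + sl \<sigma> * st \<sigma> \<noteq> 0
     \<and> (of_real kl ^ 2 + of_real kt ^ 2 - (of_real kl * of_real kt * \<sigma>)\<^sup>2 :: complex) \<noteq> 0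
     \<and> ampl \<sigma> \<noteq> 0 \<and> corr \<sigma> \<noteq> 0 \<and> norm (phase_shift \<sigma>) < 1
     \<and> norm \<sigma> < 2 * h * \<alpha> * norm (corr \<sigma>) * exp (- 1)) (nhds 0)"
proof -
  have lim: "(f \<longlongrightarrow> f 0) (nhds 0)" if "f analytic_on {0}" for f :: "complex \<Rightarrow> complex"
    using analytic_at_imp_isCont[OF that] by (simp add: continuous_at tendsto_at_iff_tendsto_nhds)
  note lims = lim[OF analytic_sl] lim[OF analytic_st] lim[OF analytic_ampl] lim[OF analytic_corr]
    lim[OF analytic_phase_shift]
  have id: "((\<lambda>\<sigma>. \<sigma>) \<longlongrightarrow> 0) (nhds (0::complex))" by (rule filterlim_ident)
  have 1: "eventually (\<lambda>\<sigma>. 1 + sl \<sigma> \<noteq> 0) (nhds 0)"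
    by (rule tendsto_imp_eventually_ne[of _ "1 + sl 0"]) (auto intro!: tendsto_intros lims simp del: coeffs_at_0, simp)
  have 2: "eventually (\<lambda>\<sigma>. 1 + st \<sigma> \<noteq> 0) (nhds 0)"
    by (rule tendsto_imp_eventually_ne[of _ "1 + st 0"]) (auto intro!: tendsto_intros lims simp del: coeffs_at_0, simp)
  have 3: "eventually (\<lambda>\<sigma>. sl \<sigma> + st \<sigma> \<noteq> 0) (nhds 0)"
    by (rule tendsto_imp_eventually_ne[of _ "sl 0 + st 0"]) (auto intro!: tendsto_intros lims simp del: coeffs_at_0, simp)
  have 4: "eventually (\<lambda>\<sigma>. 1 + sl \<sigma> * st \<sigma> \<noteq> 0) (nhds 0)"
    by (rule tendsto_imp_eventually_ne[of _ "1 + sl 0 * st 0"]) (auto intro!: tendsto_intros lims simp del: coeffs_at_0, simp)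
  have 5: "eventually (\<lambda>\<sigma>. (of_real kl ^ 2 + of_real kt ^ 2 - (of_real kl * of_real kt * \<sigma>)\<^sup>2 :: complex) \<noteq> 0) (nhds 0)"
    by (rule tendsto_imp_eventually_ne[OF lim], intro analytic_intros) (use sq_sum_nz in simp)
  have 6: "eventually (\<lambda>\<sigma>. ampl \<sigma> \<noteq> 0) (nhds 0)"
    by (rule tendsto_imp_eventually_ne[OF lims(3)]) simp
  have 7: "eventually (\<lambda>\<sigma>. corr \<sigma> \<noteq> 0) (nhds 0)"
    by (rule tendsto_imp_eventually_ne[OF lims(4)]) simp
  have 8: "eventually (\<lambda>\<sigma>. norm (phase_shift \<sigma>) < 1) (nhds 0)"
    by (rule order_tendstoD(2)[OF tendsto_norm[OF lims(5)]]) simp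
  have 9: "eventually (\<lambda>\<sigma>. norm \<sigma> < 2 * h * \<alpha> * norm (corr \<sigma>) * exp (- 1)) (nhds 0)"
  proof -
    have "((\<lambda>\<sigma>. 2 * h * \<alpha> * norm (corr \<sigma>) * exp (- 1) - norm \<sigma>) \<longlongrightarrow>
        2 * h * \<alpha> * norm (corr 0) * exp (- 1) - norm (0::complex)) (nhds 0)"
      by (intro tendsto_intros lims id)
    moreover have "2 * h * \<alpha> * norm (corr 0) * exp (- 1) - norm (0::complex) > 0"
      using h \<alpha>_pos by simp
    ultimately have "eventually (\<lambda>\<sigma>. 2 * h * \<alpha> * norm (corr \<sigma>) * exp (- 1) - norm \<sigma> > 0) (nhds 0)"
      by (rule order_tendstoD(1))
    then show ?thesis by simp
  qed
  show ?thesis using 1 2 3 4 5 6 7 8 9 by eventually_elim blast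
qed

text \<open>\<open>Re k \<ge> 0\<close> and \<open>norm (phase_shift \<sigma>) < 1\<close> give
  \<open>norm (exp w) \<ge> exp (- 1)\<close>, whereas the root
  \<open>- \<epsilon> / (A + S)\<close> is smaller than that in modulus. Only
  \<open>exp w = \<epsilon> * (A + S)\<close> survives.\<close>

lemma dispersion_iff_exp_eq:
  obtains B where "B > 0"
   "\<And>k p q. Re k \<ge> 0 \<Longrightarrow> norm k \<ge> B \<Longrightarrow> p\<^sup>2 = (of_real kl)\<^sup>2 - k\<^sup>2 \<Longrightarrow> q\<^sup>2 = (of_real kt)\<^sup>2 - k\<^sup>2 \<Longrightarrow>
     (k\<^sup>2 * sin (q * of_real h) * cos (p * of_real h) + p * q * sin (p * of_real h) * cos (q * of_real h) = 0
      \<longleftrightarrow> exp (2 * of_real h * k) = of_real \<alpha> * (2 * of_real h * k) * exp (log_corr (1 / k)))"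
   "\<And>k p q. Re k \<ge> 0 \<Longrightarrow> norm k \<ge> B \<Longrightarrow> p\<^sup>2 = (of_real kl)\<^sup>2 - k\<^sup>2 \<Longrightarrow> q\<^sup>2 = (of_real kt)\<^sup>2 - k\<^sup>2 \<Longrightarrow>
     (k\<^sup>2 * sin (p * of_real h) * cos (q * of_real h) + p * q * sin (q * of_real h) * cos (p * of_real h) = 0
      \<longleftrightarrow> exp (2 * of_real h * k) = - (of_real \<alpha> * (2 * of_real h * k) * exp (log_corr (1 / k))))"
proof -
  obtain e where e: "e > 0" and near: "\<And>\<sigma>. norm \<sigma> < e \<Longrightarrow> 
     1 + sl \<sigma> \<noteq> 0 \<and> 1 + st \<sigma> \<noteq> 0 \<and> sl \<sigma> + st \<sigma> \<noteq> 0 \<and> 1 + sl \<sigma> * st \<sigma> \<noteq> 0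
     \<and> (of_real kl ^ 2 + of_real kt ^ 2 - (of_real kl * of_real kt * \<sigma>)\<^sup>2 :: complex) \<noteq> 0
     \<and> ampl \<sigma> \<noteq> 0 \<and> corr \<sigma> \<noteq> 0 \<and> norm (phase_shift \<sigma>) < 1
     \<and> norm \<sigma> < 2 * h * \<alpha> * norm (corr \<sigma>) * exp (- 1)"
    using eventually_near_0 unfolding eventually_nhds_metric dist_norm diff_0_right by metis
  define B where "B = 2 / e"
  have B: "B > 0" using e by (simp add: B_def)
  have main: "(1 - sl (1/k) * st (1/k)) * sinh (k * of_real h * (sl (1/k) + st (1/k)))
        = \<epsilon> * ((1 + sl (1/k) * st (1/k)) * sinh (k * of_real h * (sl (1/k) - st (1/k))))
      \<longleftrightarrow> exp (2 * of_real h * k) = \<epsilon> * (of_real \<alpha> * (2 * of_real h * k) * exp (log_corr (1 / k)))"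
    if k: "Re k \<ge> 0" "norm k \<ge> B" and \<epsilon>: "\<epsilon> = 1 \<or> \<epsilon> = - 1" for k \<epsilon> :: complex
  proof -
    have nk: "norm k > 0" using k B by linarith
    then have k0: "k \<noteq> 0" by auto
    define \<sigma> where "\<sigma> = 1 / k"
    have k\<sigma>: "k * \<sigma> = 1" using k0 by (simp add: \<sigma>_def)
    have "norm \<sigma> < e"
    proof -
      have "2 / e \<le> norm k" using k by (simp add: B_def)
      then have "2 \<le> norm k * e" using e by (simp add: field_simps)
      then have "1 < norm k * e" by linarith
      then show ?thesis using nk by (simp add: \<sigma>_def norm_divide field_simps)
    qed
    note near = near[OF this]
    define A where "A = of_real (\<alpha> * h) * k * ampl \<sigma>"
    \<comment> \<open>This square root of \<open>A\<^sup>2 + 1\<close> is the one asymptotic to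
      \<open>A\<close>, and \<open>S / A\<close> is analytic in \<open>\<sigma>\<close> at
      0.\<close>
    define S where "S = A * csqrt (1 + (1 / A)\<^sup>2)"
    define w where "w = k * of_real h * (sl \<sigma> + st \<sigma>)"
    have ah: "of_real (\<alpha> * h) \<noteq> (0::complex)" using \<alpha>_pos h by simp
    have A0: "A \<noteq> 0" using ah k0 near by (simp add: A_def)
    have invA: "1 / A = \<sigma> / (of_real (\<alpha> * h) * ampl \<sigma>)"
      using k0 by (simp add: A_def \<sigma>_def)
    have S: "S\<^sup>2 = A\<^sup>2 + 1"
      using A0 by (simp add: S_def power_mult_distrib field_simps)
    have AS: "A + S = of_real \<alpha> * (2 * of_real h * k) * corr \<sigma>"
    proof -
      have "A + S = A * (1 + csqrt (1 + (1 / A)\<^sup>2))" by (simp add: S_def algebra_simps)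
      also have "\<dots> = of_real \<alpha> * (2 * of_real h * k) * corr \<sigma>"
        unfolding invA by (simp add: corr_def A_def)
      finally show ?thesis .
    qed
    have "(1 - sl \<sigma> * st \<sigma>) * (1 + sl \<sigma> * st \<sigma>) = 1 - (sl \<sigma>)\<^sup>2 * (st \<sigma>)\<^sup>2"
      by (simp add: algebra_simps power2_eq_square)
    also have "\<dots> = \<sigma>\<^sup>2 * (of_real kl ^ 2 + of_real kt ^ 2 - (of_real kl * of_real kt * \<sigma>)\<^sup>2)"
      unfolding csqrt_sq by (simp add: algebra_simps power2_eq_square)
    also have "\<dots> \<noteq> 0" using near k0 by (simp add: \<sigma>_def)
    finally have ss: "1 - sl \<sigma> * st \<sigma> \<noteq> 0" by auto
    have "(1 - sl \<sigma> * st \<sigma>) * sinh w = \<epsilon> * ((1 + sl \<sigma> * st \<sigma>) * sinh (k * of_real h * (sl \<sigma> - st \<sigma>)))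
       \<longleftrightarrow> (1 - sl \<sigma> * st \<sigma>) * sinh w = \<epsilon> * ((1 - sl \<sigma> * st \<sigma>) * A)"
      using ampl_eq[OF k\<sigma>] near by (simp add: A_def)
    also have "\<dots> \<longleftrightarrow> (1 - sl \<sigma> * st \<sigma>) * sinh w = (1 - sl \<sigma> * st \<sigma>) * (\<epsilon> * A)"
      by (simp only: mult.left_commute)
    also have "\<dots> \<longleftrightarrow> sinh w = \<epsilon> * A" using ss by simp
    also have "\<dots> \<longleftrightarrow> exp w = \<epsilon> * (A + S) \<or> exp w = - \<epsilon> / (A + S)"
      using \<epsilon> by (intro sinh_eq_iff_exp S) auto
    also have "\<dots> \<longleftrightarrow> exp w = \<epsilon> * (A + S)"
    proof -
      have w: "w = 2 * of_real h * k - phase_shift \<sigma>"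
        unfolding w_def using k\<sigma> near by (intro phase_eq) auto
      have "Re w = 2 * h * Re k - Re (phase_shift \<sigma>)" by (simp add: w)
      moreover have "Re (phase_shift \<sigma>) \<le> norm (phase_shift \<sigma>)" by (rule complex_Re_le_cmod)
      moreover have "2 * h * Re k \<ge> 0" using h k by simp
      moreover have "norm (phase_shift \<sigma>) < 1" using near by blast
      ultimately have "Re w \<ge> - 1" by linarith
      then have 1: "norm (exp w) \<ge> exp (- 1)" by simp
      have "norm (A + S) = 2 * h * \<alpha> * norm (corr \<sigma>) * norm k"
        unfolding AS using \<alpha>_pos h by (simp add: norm_mult)
      moreover have "norm \<sigma> * norm k < 2 * h * \<alpha> * norm (corr \<sigma>) * exp (- 1) * norm k"
        using near nk by (intro mult_strict_right_mono) auto
      moreover have "norm \<sigma> * norm k = 1" using k\<sigma> by (metis mult.commute norm_mult norm_one)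
      ultimately have "1 < norm (A + S) * exp (- 1)" by (simp add: mult_ac)
      moreover have "norm \<epsilon> = 1" using \<epsilon> by auto
      moreover have "norm (A + S) > 0"
        using \<open>1 < norm (A + S) * exp (- 1)\<close> by (cases "A + S = 0") auto
      ultimately have "norm (- \<epsilon> / (A + S)) < exp (- 1)"
        by (simp add: norm_divide divide_simps mult.commute)
      with 1 have "exp w \<noteq> - \<epsilon> / (A + S)" by (metis not_le)
      then show ?thesis by simp
    qed
    also have "\<dots> \<longleftrightarrow> exp (2 * of_real h * k) = \<epsilon> * (A + S) * exp (phase_shift \<sigma>)"
    proof -
      have w: "2 * of_real h * k = w + phase_shift \<sigma>"
        using phase_eq[OF k\<sigma>] near by (simp add: w_def)
      show ?thesis unfolding w exp_add by simp
    qed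
    also have "\<epsilon> * (A + S) * exp (phase_shift \<sigma>) = \<epsilon> * (of_real \<alpha> * (2 * of_real h * k) * exp (log_corr \<sigma>))"
      unfolding AS log_corr_def exp_add using near by (simp add: mult_ac)
    finally show ?thesis by (simp only: w_def \<sigma>_def)
  qed
  have pq: "p\<^sup>2 = (\<i> * k * sl (1/k))\<^sup>2" "q\<^sup>2 = (\<i> * k * st (1/k))\<^sup>2"
    if "k \<noteq> 0" "p\<^sup>2 = (of_real kl)\<^sup>2 - k\<^sup>2" "q\<^sup>2 = (of_real kt)\<^sup>2 - k\<^sup>2" for k p q :: complex
  proof -
    have *: "(\<i> * k * s)\<^sup>2 = (of_real a)\<^sup>2 - k\<^sup>2" if "s\<^sup>2 = 1 - (of_real a * (1 / k))\<^sup>2" for s and a :: real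
    proof -
      have "(\<i> * k * s)\<^sup>2 = - (k\<^sup>2 * s\<^sup>2)" by (simp add: power_mult_distrib)
      also have "\<dots> = (k * (of_real a * (1 / k)))\<^sup>2 - k\<^sup>2"
        unfolding that by (simp only: power_mult_distrib) (simp add: algebra_simps)
      finally show ?thesis using \<open>k \<noteq> 0\<close> by simp
    qed
    show "p\<^sup>2 = (\<i> * k * sl (1/k))\<^sup>2" "q\<^sup>2 = (\<i> * k * st (1/k))\<^sup>2"
      using that(2,3) by (simp_all only: *[OF csqrt_sq(1)] *[OF csqrt_sq(2)])
  qed
  show ?thesis
  proof (rule that[OF B])
    fix k p q :: complex
    assume k: "Re k \<ge> 0" "norm k \<ge> B" and p: "p\<^sup>2 = (of_real kl)\<^sup>2 - k\<^sup>2" and q: "q\<^sup>2 = (of_real kt)\<^sup>2 - k\<^sup>2"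
    have k0: "k \<noteq> 0" using k B by auto
    show "k\<^sup>2 * sin (q * of_real h) * cos (p * of_real h) + p * q * sin (p * of_real h) * cos (q * of_real h) = 0
      \<longleftrightarrow> exp (2 * of_real h * k) = of_real \<alpha> * (2 * of_real h * k) * exp (log_corr (1 / k))"
      unfolding dispersion_hyperbolic[OF k0 pq[OF k0 p q]]
      using main[OF k, of 1] by simp
    \<comment> \<open>Exchanging \<open>p\<close> and \<open>q\<close> exchanges \<open>sl\<close>
      and \<open>st\<close>; the odd factor \<open>sinh (k h (sl - st))\<close> then changes sign,
      whence \<open>\<epsilon> = - 1\<close>.\<close>
    have "k\<^sup>2 * sin (p * of_real h) * cos (q * of_real h) + q * p * sin (q * of_real h) * cos (p * of_real h) = 0
      \<longleftrightarrow> (1 - st (1/k) * sl (1/k)) * sinh (k * of_real h * (st (1/k) + sl (1/k)))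
         = (1 + st (1/k) * sl (1/k)) * sinh (k * of_real h * (st (1/k) - sl (1/k)))"
      by (rule dispersion_hyperbolic[OF k0 pq(2)[OF k0 p q] pq(1)[OF k0 p q]])
    also have "k * of_real h * (st (1/k) - sl (1/k)) = - (k * of_real h * (sl (1/k) - st (1/k)))"
      by (simp add: algebra_simps)
    finally show "k\<^sup>2 * sin (p * of_real h) * cos (q * of_real h) + p * q * sin (q * of_real h) * cos (p * of_real h) = 0
      \<longleftrightarrow> exp (2 * of_real h * k) = - (of_real \<alpha> * (2 * of_real h * k) * exp (log_corr (1 / k)))"
      using main[OF k, of "- 1"] by (simp add: mult.commute[of "sl (1/k)"] mult.commute[of p] add.commute[of "sl (1/k)"])
  qed
qed

end

section \<open>Wavenumbers of bounded modulus\<close>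

text \<open>Evenness hides the sign jump of the root. Off the positive axis
  \<open>\<i> * csqrt (- w)\<close> is a holomorphic root on which \<open>g\<close> takes the same
  values, so the two slit planes cover everything but 0, where continuity removes the
  singularity.\<close>

lemma holomorphic_even_csqrt:
  assumes g: "g holomorphic_on UNIV" and even: "\<And>x. g (- x) = g x"
  shows "(\<lambda>w. g (csqrt w)) holomorphic_on UNIV"
proof (rule no_isolated_singularity'[where K = "{0}"])
  have "((\<lambda>w. csqrt w) \<longlongrightarrow> 0) (at 0)"
  proof (rule Lim_null_comparison)
    show "eventually (\<lambda>w. norm (csqrt w) \<le> sqrt (norm w)) (at 0)" by simp
    have "((\<lambda>w::complex. sqrt (norm w)) \<longlongrightarrow> sqrt (norm (0::complex))) (at 0)"
      by (intro tendsto_intros)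
    then show "((\<lambda>w::complex. sqrt (norm w)) \<longlongrightarrow> 0) (at 0)" by simp
  qed
  moreover have "isCont g 0"
    using holomorphic_on_imp_continuous_on[OF g] by (simp add: continuous_on_eq_continuous_at)
  ultimately have "((\<lambda>w. g (csqrt w)) \<longlongrightarrow> g 0) (at 0)"
    by (rule isCont_tendsto_compose[rotated])
  then show "((\<lambda>w. g (csqrt w)) \<longlongrightarrow> g (csqrt z)) (at z within UNIV)" if "z \<in> {0}" for z
    using that by simp
  have 1: "(\<lambda>w. g (csqrt w)) holomorphic_on - \<real>\<^sub>\<le>\<^sub>0"
    using holomorphic_on_compose_gen[OF holomorphic_on_csqrt g] by (simp add: o_def)
  have 2: "(\<lambda>w. g (csqrt w)) holomorphic_on - \<real>\<^sub>\<ge>\<^sub>0"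
  proof (rule holomorphic_transform)
    have "(\<lambda>w. \<i> * csqrt (- w)) holomorphic_on - \<real>\<^sub>\<ge>\<^sub>0"
      by (intro holomorphic_intros) (auto simp: complex_nonpos_Reals_iff complex_nonneg_Reals_iff)
    from holomorphic_on_compose_gen[OF this g]
    show "(\<lambda>w. g (\<i> * csqrt (- w))) holomorphic_on - \<real>\<^sub>\<ge>\<^sub>0" by (simp add: o_def)
    show "g (\<i> * csqrt (- w)) = g (csqrt w)" for w
    proof -
      have "(\<i> * csqrt (- w))\<^sup>2 = (csqrt w)\<^sup>2" by (simp add: power_mult_distrib)
      then have "\<i> * csqrt (- w) = csqrt w \<or> \<i> * csqrt (- w) = - csqrt w" by (simp only: power2_eq_iff)
      then show ?thesis using even[of "csqrt w"] by auto
    qed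
  qed
  have "(\<lambda>w. g (csqrt w)) holomorphic_on (- \<real>\<^sub>\<le>\<^sub>0) \<union> (- \<real>\<^sub>\<ge>\<^sub>0)"
    by (intro holomorphic_on_Un 1 2) (auto simp: open_Compl)
  then show "(\<lambda>w. g (csqrt w)) holomorphic_on UNIV - {0}"
    by (rule holomorphic_on_subset) (auto simp: complex_nonpos_Reals_iff complex_nonneg_Reals_iff complex_eq_iff)
qed auto

text \<open>The point \<open>k0\<close> certifies that \<open>q F\<close> does not vanish
  identically; zeros of \<open>F\<close> are among those of \<open>q F\<close>.\<close>

lemma finite_dispersion_zeros:
  fixes a b h :: complex and p q :: "complex \<Rightarrow> complex"
  assumes p: "\<And>k. (p k)\<^sup>2 = a - k\<^sup>2" and q: "\<And>k. (q k)\<^sup>2 = b - k\<^sup>2"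
  defines "F \<equiv> \<lambda>k. k\<^sup>2 * sin (q k * h) * cos (p k * h) + p k * q k * sin (p k * h) * cos (q k * h)"
  assumes k0: "F k0 \<noteq> 0" "q k0 \<noteq> 0"
  shows "finite {k \<in> cball 0 K. F k = 0}"
proof -
  define S where "S w = csqrt w * sin (csqrt w * h)" for w
  define C where "C w = cos (csqrt w * h)" for w
  have S: "S holomorphic_on UNIV"
    unfolding S_def[abs_def]
    by (rule holomorphic_even_csqrt[where g = "\<lambda>x. x * sin (x * h)"]) (auto intro!: holomorphic_intros)
  have C: "C holomorphic_on UNIV"
    unfolding C_def[abs_def]
    by (rule holomorphic_even_csqrt[where g = "\<lambda>x. cos (x * h)"]) (auto intro!: holomorphic_intros)
  have SC: "x * sin (x * h) = S (x\<^sup>2)" "cos (x * h) = C (x\<^sup>2)" for x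
  proof -
    have gen: "x * sin (x * h) = r * sin (r * h) \<and> cos (x * h) = cos (r * h)" if "x = r \<or> x = - r" for r
      using that by auto
    have "x\<^sup>2 = (csqrt (x\<^sup>2))\<^sup>2" by simp
    then have "x = csqrt (x\<^sup>2) \<or> x = - csqrt (x\<^sup>2)" by (simp only: power2_eq_iff)
    from gen[OF this] show "x * sin (x * h) = S (x\<^sup>2)" "cos (x * h) = C (x\<^sup>2)"
      by (simp_all only: S_def C_def)
  qed
  \<comment> \<open>The factor \<open>q\<close> makes every term even in \<open>p\<close> and in \<open>q\<close>, so \<open>H = q F\<close> is entire although
    \<open>p\<close> and \<open>q\<close> are arbitrary, possibly discontinuous, square roots.\<close>
  define H where "H k = k\<^sup>2 * S (b - k\<^sup>2) * C (a - k\<^sup>2) + (b - k\<^sup>2) * S (a - k\<^sup>2) * C (b - k\<^sup>2)" for k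
  have H: "H k = q k * F k" for k
  proof -
    have "q k * F k = k\<^sup>2 * (q k * sin (q k * h)) * cos (p k * h) + (q k)\<^sup>2 * (p k * sin (p k * h)) * cos (q k * h)"
      by (simp add: F_def algebra_simps power2_eq_square)
    also have "\<dots> = H k" unfolding SC p q H_def ..
    finally show ?thesis by simp
  qed
  have comp: "(\<lambda>k. S (c - k\<^sup>2)) holomorphic_on UNIV" "(\<lambda>k. C (c - k\<^sup>2)) holomorphic_on UNIV" for c
  proof -
    have "(\<lambda>k. c - k\<^sup>2) holomorphic_on UNIV" by (intro holomorphic_intros)
    from holomorphic_on_compose_gen[OF this S] holomorphic_on_compose_gen[OF this C]
    show "(\<lambda>k. S (c - k\<^sup>2)) holomorphic_on UNIV" "(\<lambda>k. C (c - k\<^sup>2)) holomorphic_on UNIV"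
      by (simp_all add: o_def)
  qed
  have holo: "H holomorphic_on UNIV"
    unfolding H_def[abs_def] by (intro holomorphic_intros comp)
  have "finite {k \<in> cball 0 K. H k = 0}"
  proof (cases "H constant_on UNIV")
    case True
    then obtain c where c: "\<And>k. H k = c" by (auto simp: constant_on_def)
    moreover have "c \<noteq> 0" using k0 by (simp add: H flip: c[of k0])
    ultimately have "{k \<in> cball 0 K. H k = 0} = {}" by simp
    then show ?thesis by (simp only: finite.emptyI)
  next
    case False
    with holo show ?thesis by (intro holomorphic_compact_finite_zeros[of H UNIV]) auto
  qed
  then show ?thesis by (rule rev_finite_subset) (auto simp: H)
qed

section \<open>Enumeration of the wavenumbers\<close>

context clamped_plate
begin

text \<open>The phase \<open>b\<close> encodes the sign as \<open>exp (- i b)\<close> and also fixes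
  the numbering, since \<open>n\<close> enters only through \<open>2 * pi * n - b\<close>.\<close>

lemma enumeration_from_exp_eq:
  fixes b B :: real and S :: "complex set"
  assumes S: "\<And>k. Re k \<ge> 0 \<Longrightarrow> norm k \<ge> B \<Longrightarrow> k \<in> S \<longleftrightarrow>
      exp (2 * of_real h * k) = of_real \<alpha> * (2 * of_real h * k) * exp (log_corr (1 / k) - \<i> * of_real b)"
    and fin: "\<And>k0 K. k0 \<notin> S \<Longrightarrow> norm k0 > kt \<Longrightarrow> finite (S \<inter> cball 0 K)"
  shows "\<exists>n0\<ge>1. \<exists>k. enumerates_up_to_finite n0 k (S \<inter> closed_first_quadrant) \<and>
    (\<lambda>n. k n - (of_real (1 / (2 * h) * ln (2 * \<alpha> * pi * real n) - (b - pi / 2) / (4 * pi * h * real n))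
        + \<i> / of_real (2 * h) * of_real (2 * pi * real n - (b - pi / 2)
            - ln (2 * \<alpha> * pi * real n) / (2 * pi * real n)
            - h\<^sup>2 * (kl\<^sup>2 + kt\<^sup>2) / (2 * pi * real n)))) \<in> o(\<lambda>n. 1 / of_nat n)"
proof -
  define \<rho> where "\<rho> u = log_corr (2 * of_real h * u)" for u
  define C :: complex where "C = of_real (h\<^sup>2 * (kl\<^sup>2 + kt\<^sup>2))"
  have h0: "(of_real h :: complex) \<noteq> 0" using h by simp
  have \<rho>_an: "\<rho> analytic_on {0}"
  proof -
    have "(\<lambda>u::complex. 2 * of_real h * u) analytic_on {0}" by (intro analytic_intros)
    from analytic_on_compose_gen[OF this analytic_log_corr] show ?thesis
      by (simp add: o_def \<rho>_def[abs_def])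
  qed
  have \<rho>0: "\<rho> 0 = 0" by (simp add: \<rho>_def)
  have \<rho>': "(\<rho> has_field_derivative C) (at 0)"
  proof -
    have "((\<lambda>u::complex. 2 * of_real h * u) has_field_derivative 2 * of_real h) (at 0)"
      by (auto intro!: derivative_eq_intros)
    moreover have "(log_corr has_field_derivative of_real (h * (kl\<^sup>2 + kt\<^sup>2) / 2)) (at (2 * of_real h * 0))"
      using has_field_derivative_log_corr_0 by simp
    ultimately have "(\<rho> has_field_derivative of_real (h * (kl\<^sup>2 + kt\<^sup>2) / 2) * (2 * of_real h)) (at 0)"
      unfolding \<rho>_def[abs_def] by (rule DERIV_chain2[rotated])
    also have "of_real (h * (kl\<^sup>2 + kt\<^sup>2) / 2) * (2 * of_real h) = C"
      by (simp add: C_def power2_eq_square)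
    finally show ?thesis .
  qed
  obtain N Z B1 where N: "N \<ge> 1" and inj: "inj_on Z {N..}"
    and Z: "\<And>n. n \<ge> N \<Longrightarrow> Z n = of_real (ln \<alpha>) + Ln (Z n) + \<rho> (1 / Z n) + \<i> * of_real (2 * pi * real n - b)
       \<and> Re (Z n) \<ge> 0 \<and> Im (Z n) \<ge> 1 \<and> norm (Z n) \<ge> 2 * h * B \<and> norm (\<rho> (1 / Z n)) \<le> 1"
    and Z_exp: "\<And>n. n \<ge> N \<Longrightarrow> exp (Z n) = of_real \<alpha> * Z n * exp (\<rho> (1 / Z n) - \<i> * of_real b)"
    and complete: "\<And>z. Re z \<ge> 0 \<Longrightarrow> Im z \<ge> 0 \<Longrightarrow> norm z \<ge> B1 \<Longrightarrow>
       exp z = of_real \<alpha> * z * exp (\<rho> (1 / z) - \<i> * of_real b) \<Longrightarrow> z \<in> Z ` {N..}"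
    by (rule exp_eq_linear_perturbed_fixpoints[OF \<alpha>_pos \<rho>_an \<rho>0, where b = b and ?B0.0 = "2 * h * B"]) blast
  define k where "k n = Z n / (2 * of_real h)" for n
  define B2 where "B2 = Max {B, B1 / (2 * h), kt + 1}"
  have B2: "B2 \<ge> B" "B2 \<ge> B1 / (2 * h)" "B2 \<ge> kt + 1" by (auto simp: B2_def)
  have Zk: "Z n = 2 * of_real h * k n" for n using h0 by (simp add: k_def)
  have \<rho>k: "\<rho> (1 / (2 * of_real h * x)) = log_corr (1 / x)" for x
    using h0 by (simp add: \<rho>_def)
  have big: "x \<in> k ` {N..}" if "x \<in> S" "Re x \<ge> 0" "Im x \<ge> 0" "norm x \<ge> B2" for x
  proof -
    have "exp (2 * of_real h * x) = of_real \<alpha> * (2 * of_real h * x) * exp (log_corr (1 / x) - \<i> * of_real b)"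
      using S[of x] that B2 by auto
    moreover have "norm (2 * of_real h * x) \<ge> B1"
    proof -
      have "B1 / (2 * h) \<le> norm x" using that B2 by linarith
      then have "B1 \<le> 2 * h * norm x" using h by (simp add: field_simps)
      then show ?thesis using h by (simp add: norm_mult)
    qed
    ultimately have "2 * of_real h * x \<in> Z ` {N..}"
      using that h by (intro complete) (auto simp: \<rho>k)
    then obtain n where "n \<ge> N" "2 * of_real h * x = Z n" by auto
    then have "x = k n" using h0 by (simp add: k_def field_simps)
    with \<open>n \<ge> N\<close> show ?thesis by auto
  qed
  have quad: "Re (k n) \<ge> 0" "Im (k n) > 0" "norm (k n) \<ge> B" if "n \<ge> N" for n
  proof -
    have ReIm: "Re (Z n) = (2 * h) * Re (k n)" "Im (Z n) = (2 * h) * Im (k n)" by (simp_all add: Zk)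
    have Zn: "Re (Z n) \<ge> 0" "Im (Z n) \<ge> 1" "norm (Z n) \<ge> 2 * h * B" using Z[OF that] by blast+
    show "Re (k n) \<ge> 0" using Zn(1) h unfolding ReIm by (simp add: zero_le_mult_iff)
    have "(2 * h) * Im (k n) > 0" using Zn(2) unfolding ReIm by linarith
    then show "Im (k n) > 0" using h by (simp add: zero_less_mult_iff)
    have "2 * h * B \<le> 2 * h * norm (k n)"
      using Zn(3) h by (simp add: Zk norm_mult)
    then show "norm (k n) \<ge> B" using h by simp
  qed
  have mem: "k n \<in> S" if "n \<ge> N" for n
    using S[OF quad(1,3)[OF that]] Z_exp[OF that] unfolding Zk \<rho>k by simp
  \<comment> \<open>A large positive real number is no solution: it would be some
    \<open>k n\<close>, but these have positive imaginary part. This supplies the point outside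
    \<open>S\<close> that the finiteness argument needs.\<close>
  define x0 :: complex where "x0 = of_real (max B2 (kt + 1))"
  have x0: "norm x0 \<ge> B2" "norm x0 > kt" "Re x0 \<ge> 0" "Im x0 = 0"
    using kt kl by (auto simp: x0_def)
  have "x0 \<notin> S"
  proof
    assume "x0 \<in> S"
    then have "x0 \<in> k ` {N..}" using x0 by (intro big) auto
    then show False using quad(2) x0(4) by force
  qed
  from fin[OF this x0(2)] have fin': "finite (S \<inter> cball 0 B2)" .
  have "enumerates_up_to_finite N k (S \<inter> closed_first_quadrant)"
    unfolding enumerates_up_to_finite_def
  proof (intro conjI)
    show "inj_on k {N..}"
      using inj h0 by (auto simp: inj_on_def k_def)
    show "k ` {N..} \<subseteq> S \<inter> closed_first_quadrant"
      using mem quad by (force simp: closed_first_quadrant_def)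
    show "finite (S \<inter> closed_first_quadrant - k ` {N..})"
      by (rule finite_subset[OF _ fin']) (use big in \<open>force simp: closed_first_quadrant_def\<close>)
  qed
  moreover have "(\<lambda>n. k n - (of_real (1 / (2 * h) * ln (2 * \<alpha> * pi * real n) - (b - pi / 2) / (4 * pi * h * real n))
        + \<i> / of_real (2 * h) * of_real (2 * pi * real n - (b - pi / 2)
            - ln (2 * \<alpha> * pi * real n) / (2 * pi * real n)
            - h\<^sup>2 * (kl\<^sup>2 + kt\<^sup>2) / (2 * pi * real n)))) \<in> o(\<lambda>n. 1 / of_nat n)"
  proof (rule smalloI_tendsto)
    define E where "E n = of_nat n * (Z n -
      (of_real (ln (2 * \<alpha> * pi * real n)) + \<i> * of_real (2 * pi * real n - b + pi / 2)
       + (of_real (ln (2 * \<alpha> * pi * real n)) + \<i> * of_real (pi / 2 - b) + C)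
         / (2 * of_real pi * \<i> * of_nat n)))" for n
    have "E \<longlonglongrightarrow> 0"
      unfolding E_def[abs_def]
      by (rule log_fixpoint_asymptotics[OF \<alpha>_pos \<rho>0 \<rho>', of N]) (use Z in blast)+
    then have "(\<lambda>n. E n / (2 * of_real h)) \<longlonglongrightarrow> 0 / (2 * of_real h)"
      by (rule tendsto_divide[OF _ tendsto_const]) (use h0 in simp)
    then have "(\<lambda>n. E n / (2 * of_real h)) \<longlonglongrightarrow> 0" by simp
    moreover have "eventually (\<lambda>n. E n / (2 * of_real h) =
       (k n - (of_real (1 / (2 * h) * ln (2 * \<alpha> * pi * real n) - (b - pi / 2) / (4 * pi * h * real n))
        + \<i> / of_real (2 * h) * of_real (2 * pi * real n - (b - pi / 2)
            - ln (2 * \<alpha> * pi * real n) / (2 * pi * real n)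
            - h\<^sup>2 * (kl\<^sup>2 + kt\<^sup>2) / (2 * pi * real n)))) / (1 / of_nat n)) sequentially"
      using eventually_gt_at_top[of 0]
    proof eventually_elim
      case (elim n)
      define L :: complex where "L = of_real (ln (2 * \<alpha> * pi * real n))"
      define x y m :: complex where "x = L + C" and "y = of_real (pi / 2 - b)" and "m = 2 * of_real pi * of_nat n"
      have m: "m \<noteq> 0" using elim by (simp add: m_def)
      \<comment> \<open>Dividing by \<open>\<i>\<close> swaps the parts: the phase \<open>y\<close>
        yields the \<open>1/n\<close> correction of the real part, \<open>L + C\<close> that of the
        imaginary part.\<close>
      have q: "(L + \<i> * y + C) / (\<i> * m) = y / m - \<i> * (x / m)"
        using m by (simp add: x_def field_simps)
      have e: "E n = of_nat n * (Z n - (L + \<i> * (m + y) + (y / m - \<i> * (x / m))))"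
        unfolding q[symmetric] by (simp add: E_def L_def y_def m_def mult_ac algebra_simps)
      have t1: "of_real (1 / (2 * h) * ln (2 * \<alpha> * pi * real n) - (b - pi / 2) / (4 * pi * h * real n))
        = (L + y / m) / (2 * of_real h)"
        using h0 elim by (simp add: L_def y_def m_def field_simps)
      have t2: "\<i> / of_real (2 * h) * of_real (2 * pi * real n - (b - pi / 2)
            - ln (2 * \<alpha> * pi * real n) / (2 * pi * real n)
            - h\<^sup>2 * (kl\<^sup>2 + kt\<^sup>2) / (2 * pi * real n)) = \<i> * (m + y - x / m) / (2 * of_real h)"
        using h0 elim by (simp add: L_def y_def m_def x_def C_def add_divide_distrib diff_divide_distrib)
      show ?case
        unfolding t1 t2 e k_def by (simp add: add_divide_distrib diff_divide_distrib algebra_simps)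
    qed
    ultimately show "(\<lambda>n. (k n - (of_real (1 / (2 * h) * ln (2 * \<alpha> * pi * real n) - (b - pi / 2) / (4 * pi * h * real n))
        + \<i> / of_real (2 * h) * of_real (2 * pi * real n - (b - pi / 2)
            - ln (2 * \<alpha> * pi * real n) / (2 * pi * real n)
            - h\<^sup>2 * (kl\<^sup>2 + kt\<^sup>2) / (2 * pi * real n)))) / (1 / of_nat n)) \<longlonglongrightarrow> 0"
      by (rule Lim_transform_eventually)
    show "eventually (\<lambda>n. 1 / of_nat n \<noteq> (0::complex)) sequentially"
      using eventually_gt_at_top[of 0] by eventually_elim simp
  qed
  ultimately show ?thesis using N by blast
qed

end

theorem theorem3:
  fixes h kt kl \<alpha> :: real and p q :: "complex \<Rightarrow> complex"
  assumes "h > 0" and "kt > kl" and "kl > 0"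
    and "\<alpha> = 2 * ((kt\<^sup>2 - kl\<^sup>2) / (kl\<^sup>2 + kt\<^sup>2))"
    and "\<And>k. (p k)\<^sup>2 = (of_real kl)\<^sup>2 - k\<^sup>2"
    and "\<And>k. (q k)\<^sup>2 = (of_real kt)\<^sup>2 - k\<^sup>2"
  shows "(\<exists>n0\<ge>1. \<exists>k :: nat \<Rightarrow> complex.
            enumerates_up_to_finite n0 k (sym_dirichlet_solutions h p q \<inter> closed_first_quadrant) \<and>
            (\<lambda>n. k n -
               (of_real (1 / (2 * h) * ln (2 * \<alpha> * pi * real n) - 3 / (8 * h * real n))
                + \<i> / of_real (2 * h) *
                  of_real (pi * (2 * real n - 3 / 2)
                    - ln (2 * \<alpha> * pi * real n) / (2 * pi * real n)
                    - h\<^sup>2 * (kl\<^sup>2 + kt\<^sup>2) / (2 * pi * real n))))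
              \<in> o(\<lambda>n. 1 / of_nat n))
       \<and> (\<exists>n0\<ge>1. \<exists>k :: nat \<Rightarrow> complex.
            enumerates_up_to_finite n0 k (antisym_dirichlet_solutions h p q \<inter> closed_first_quadrant) \<and>
            (\<lambda>n. k n -
               (of_real (1 / (2 * h) * ln (2 * \<alpha> * pi * real n) - 1 / (8 * h * real n))
                + \<i> / of_real (2 * h) *
                  of_real (pi * (2 * real n - 1 / 2)
                    - ln (2 * \<alpha> * pi * real n) / (2 * pi * real n)
                    - h\<^sup>2 * (kl\<^sup>2 + kt\<^sup>2) / (2 * pi * real n))))
              \<in> o(\<lambda>n. 1 / of_nat n))"
proof -
  interpret clamped_plate h kt kl
    using assms(1-3) by unfold_locales
  have \<alpha>_eq: "\<alpha> = clamped_plate.\<alpha> kt kl"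
    using assms(4) by (simp add: \<alpha>_def)
  let ?P = "sym_dirichlet_solutions h p q" and ?Q = "antisym_dirichlet_solutions h p q"
  obtain B where
    sym: "\<And>k p q. Re k \<ge> 0 \<Longrightarrow> norm k \<ge> B \<Longrightarrow> p\<^sup>2 = (of_real kl)\<^sup>2 - k\<^sup>2 \<Longrightarrow> q\<^sup>2 = (of_real kt)\<^sup>2 - k\<^sup>2 \<Longrightarrow>
     (k\<^sup>2 * sin (q * of_real h) * cos (p * of_real h) + p * q * sin (p * of_real h) * cos (q * of_real h) = 0
      \<longleftrightarrow> exp (2 * of_real h * k) = of_real \<alpha> * (2 * of_real h * k) * exp (log_corr (1 / k)))" and
    antisym: "\<And>k p q. Re k \<ge> 0 \<Longrightarrow> norm k \<ge> B \<Longrightarrow> p\<^sup>2 = (of_real kl)\<^sup>2 - k\<^sup>2 \<Longrightarrow> q\<^sup>2 = (of_real kt)\<^sup>2 - k\<^sup>2 \<Longrightarrow>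
     (k\<^sup>2 * sin (p * of_real h) * cos (q * of_real h) + p * q * sin (q * of_real h) * cos (p * of_real h) = 0
      \<longleftrightarrow> exp (2 * of_real h * k) = - (of_real \<alpha> * (2 * of_real h * k) * exp (log_corr (1 / k))))"
    unfolding \<alpha>_eq by (rule dispersion_iff_exp_eq) blast
  \<comment> \<open>The zeros of \<open>p\<close> and \<open>q\<close> are the points with
    \<open>k = \<plusminus> kl\<close> and \<open>k = \<plusminus> kt\<close>. The multiplier making
    the dispersion function entire is \<open>q\<close> in the symmetric and \<open>p\<close> in the
    antisymmetric case.\<close>
  have nz: "p k \<noteq> 0" "q k \<noteq> 0" if "norm k > kt" for k
  proof -
    have aux: "y \<noteq> 0" if "y\<^sup>2 = (of_real a)\<^sup>2 - k\<^sup>2" "0 < a" "a \<le> kt" for y :: complex and a :: real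
    proof
      assume "y = 0"
      then have "k\<^sup>2 = (of_real a)\<^sup>2" using that by simp
      then have "k = of_real a \<or> k = - of_real a" by (simp only: power2_eq_iff)
      then have "norm k = a" using \<open>0 < a\<close> by auto
      then show False using \<open>norm k > kt\<close> \<open>a \<le> kt\<close> by simp
    qed
    show "p k \<noteq> 0" "q k \<noteq> 0"
      using aux[OF assms(5)] aux[OF assms(6)] assms(2,3) by auto
  qed
  \<comment> \<open>The phases are \<open>b = 2 * pi\<close> and \<open>b = pi\<close>. The value
    \<open>b = 0\<close> would describe the same symmetric solutions, with the index shifted by one
    against \<open>2 n - 3/2\<close>.\<close>
  have b1: "(2 * pi - pi / 2) / (4 * pi * h * real n) = 3 / (8 * h * real n)"
    "(pi - pi / 2) / (4 * pi * h * real n) = 1 / (8 * h * real n)" for n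
    by (simp_all add: field_simps)
  have b2: "2 * pi * real n - (2 * pi - pi / 2) = pi * (2 * real n - 3 / 2)"
    "2 * pi * real n - (pi - pi / 2) = pi * (2 * real n - 1 / 2)" for n
    by (simp_all add: field_simps)
  have e2: "exp (x - \<i> * of_real (2 * pi)) = exp x" for x
    using exp_integer_2pi[of 1] by (simp add: exp_diff mult_ac)
  have e1: "exp (x - \<i> * of_real pi) = - exp x" for x
    by (simp add: exp_diff)
  have "\<exists>n0\<ge>1. \<exists>k. enumerates_up_to_finite n0 k (?P \<inter> closed_first_quadrant) \<and>
    (\<lambda>n. k n - (of_real (1 / (2 * h) * ln (2 * \<alpha> * pi * real n) - (2 * pi - pi / 2) / (4 * pi * h * real n))
        + \<i> / of_real (2 * h) * of_real (2 * pi * real n - (2 * pi - pi / 2)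
            - ln (2 * \<alpha> * pi * real n) / (2 * pi * real n)
            - h\<^sup>2 * (kl\<^sup>2 + kt\<^sup>2) / (2 * pi * real n)))) \<in> o(\<lambda>n. 1 / of_nat n)"
    unfolding \<alpha>_eq
  proof (rule enumeration_from_exp_eq[where B = B])
    fix k :: complex assume "Re k \<ge> 0" "norm k \<ge> B"
    from sym[OF this assms(5,6)]
    show "k \<in> ?P \<longleftrightarrow> exp (2 * of_real h * k)
        = of_real (clamped_plate.\<alpha> kt kl) * (2 * of_real h * k) * exp (log_corr (1 / k) - \<i> * of_real (2 * pi))"
      by (simp only: sym_dirichlet_solutions_def mem_Collect_eq e2 \<alpha>_eq)
  next
    fix k0 K assume k0: "k0 \<notin> ?P" "norm k0 > kt"
    have "finite {k \<in> cball 0 K. k\<^sup>2 * sin (q k * of_real h) * cos (p k * of_real h)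
         + p k * q k * sin (p k * of_real h) * cos (q k * of_real h) = 0}"
      by (rule finite_dispersion_zeros[OF assms(5,6), of k0])
        (use k0 nz in \<open>auto simp: sym_dirichlet_solutions_def\<close>)
    then show "finite (?P \<inter> cball 0 K)"
      by (rule rev_finite_subset) (auto simp: sym_dirichlet_solutions_def)
  qed
  moreover have "\<exists>n0\<ge>1. \<exists>k. enumerates_up_to_finite n0 k (?Q \<inter> closed_first_quadrant) \<and>
    (\<lambda>n. k n - (of_real (1 / (2 * h) * ln (2 * \<alpha> * pi * real n) - (pi - pi / 2) / (4 * pi * h * real n))
        + \<i> / of_real (2 * h) * of_real (2 * pi * real n - (pi - pi / 2)
            - ln (2 * \<alpha> * pi * real n) / (2 * pi * real n)
            - h\<^sup>2 * (kl\<^sup>2 + kt\<^sup>2) / (2 * pi * real n)))) \<in> o(\<lambda>n. 1 / of_nat n)"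
    unfolding \<alpha>_eq
  proof (rule enumeration_from_exp_eq[where B = B])
    fix k :: complex assume "Re k \<ge> 0" "norm k \<ge> B"
    from antisym[OF this assms(5,6)]
    show "k \<in> ?Q \<longleftrightarrow> exp (2 * of_real h * k)
        = of_real (clamped_plate.\<alpha> kt kl) * (2 * of_real h * k) * exp (log_corr (1 / k) - \<i> * of_real pi)"
      by (simp only: antisym_dirichlet_solutions_def mem_Collect_eq e1 \<alpha>_eq mult_minus_right)
  next
    fix k0 K assume k0: "k0 \<notin> ?Q" "norm k0 > kt"
    have "finite {k \<in> cball 0 K. k\<^sup>2 * sin (p k * of_real h) * cos (q k * of_real h)
         + q k * p k * sin (q k * of_real h) * cos (p k * of_real h) = 0}"
      by (rule finite_dispersion_zeros[OF assms(6,5), of k0])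
        (use k0 nz in \<open>auto simp: antisym_dirichlet_solutions_def mult.commute[of "q k0"]\<close>)
    then show "finite (?Q \<inter> cball 0 K)"
      by (rule rev_finite_subset) (auto simp: antisym_dirichlet_solutions_def mult_ac)
  qed
  ultimately show ?thesis
    unfolding b1 b2 by (rule conjI)
qed

end
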